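(* Let $p\in(1,\infty]$ (robustness is measured in the $\ell_p$ norm), let $r>0$ and $\rho>20$. Then the following hold. (1) For every learning algorithm $A$, and any $\epsilon>0$, there exists $\mathcal D\in\mathcal F_{r,\rho}$ such that the robust sample complexity of $A$ with respect to $\mathcal D$ is at least $\Omega(\frac d\epsilon)$. Formally, there exists a constant $c>0$ such that $m_r^\epsilon(A,\mathcal D)\ge\frac{c\,d}{\epsilon}$. (2) In contrast, for any $\mathcal D\in\mathcal F_{r,\rho}$ (and any $\epsilon>0$), the max margin algorithm $M$ has standard sample complexity $O(\frac{\rho^2}{\epsilon})$. Formally, there exists a constant $c'>0$ such that $m^\epsilon(M,\mathcal D)\le\frac{c'\rho^2}{\epsilon}$.
   Context: Binary classification over $\mathbb R^d\times\{\pm1\}$. $B_p(x,r)$ is the closed $\ell_p$ ball with center $x$ and radius $r$. A classifier is a map $f:\mathbb R^d\to\{\pm1\}$. Standard loss: $\mathcal L(f,\mathcal D)=P_{(x,y)\sim\mathcal D}[f(x)\ne y]$. Robust loss: $\mathcal L_r(f,\mathcal D)=P_{(x,y)\sim\mathcal D}[\exists x'\in B_p(x,r)\text{ s.t. } f(x')\neq y]$. For a learning algorithm $A$ and training data $S$, $A_S$ is the classifier learned by $A$ from $S$. The standard sample complexity is $m^\epsilon(A,\mathcal D)=\min\{n:\mathbb E_{S\sim\mathcal D^n}\mathcal L(A_S,\mathcal D)\le\epsilon\}$ and the robust sample complexity is $m_r^\epsilon(A,\mathcal D)=\min\{n:\mathbb E_{S\sim\mathcal D^n}\mathcal L_r(A_S,\mathcal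 D)\le\epsilon\}$. Linear classifier: $f_{w,b}(x)=+1$ if $\langle w,x\rangle\ge b$ and $-1$ if $\langle w,x\rangle<b$; its decision boundary is $H_{w,b}=\{x:\langle w,x\rangle=b\}$. $\mathcal D$ is linearly $r$-separable ($r$-separated) if $\mathcal L_r(f_{w,b},\mathcal D)=0$ for some linear classifier $f_{w,b}$. For linearly separable $\mathcal D$ (some linear classifier has zero standard loss), let $S^+,S^-\subset\mathbb R^d$ be the positively and negatively labeled parts of the support. The margin $\gamma(\mathcal D)$ is the largest real $\gamma$ for which some linear classifier $f_{w,b}$ has $\mathcal L(f_{w,b},\mathcal D)=0$ and every $x\in S^+\cup S^-$ is at $\ell_2$ distance at least $\gamma$ from $H_{w,b}$. The aspect ratio is $\rho(\mathcal D)=\mathrm{diam}_2(S^+\cup S^-)/\gamma(\mathcal D)$, where $\mathrm{diam}_2$ is the $\ell_2$ diameter. $\mathcal F_{r,\rho}$ is the set of all distributions $\mathcal D$ over $\mathbb R^d\times\{\pm1\}$ that are $r$-separated (with respect to $\ell_p$) and have aspect ratio at most $\rho$. The max margin algorithm $M$ is the hard margin SVM algorithm, which returns the linear classifier separating the two classes of the sample with the largest $\ell_2$ margin.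
   Formalization: Part (1) is stated for 0 < ε ≤ ε₀ with any fixed ε₀ < 1/2, c depending only on ε₀: for ε ≥ 1/2 the constant classifier with the first example's label has expected robust loss ≤ 1/2, so no c independent of d works, and for ε ≥ 1 the sample complexity is 0. *)

theory Defs
  imports "HOL-Probability.Probability"
begin

(* The dimension d is a term, not a type, because the constants in the bounds must not
   depend on it: a vector of R^d is a function on {..<d}, extended by undefined. *)
type_synonym point = "nat \<Rightarrow> real"

(* True is the label +1 and False is the label -1. *)
type_synonym example = "point \<times> bool"
type_synonym classifier = "point \<Rightarrow> bool"

(* The empty list is the sample of size 0; a learning algorithm is any such map. *)
type_synonym algorithm = "example list \<Rightarrow> classifier"

abbreviation Rd :: "nat \<Rightarrow> point set" where
  "Rd d \<equiv> {..<d} \<rightarrow>\<^sub>E UNIV"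

definition example_space :: "nat \<Rightarrow> example measure" where
  "example_space d = (\<Pi>\<^sub>M i\<in>{..<d}. borel) \<Otimes>\<^sub>M count_space UNIV"

definition distributions :: "nat \<Rightarrow> example measure set" where
  "distributions d = {D. prob_space D \<and> sets D = sets (example_space d)}"

definition inner_d :: "nat \<Rightarrow> point \<Rightarrow> point \<Rightarrow> real" where
  "inner_d d w x = (\<Sum>i<d. w i * x i)"

definition l2_dist :: "nat \<Rightarrow> point \<Rightarrow> point \<Rightarrow> real" where
  "l2_dist d x y = L2_set (\<lambda>i. x i - y i) {..<d}"

(* Meant for d \<ge> 1 and 1 \<le> p \<le> \<infinity>. *)
definition lp_dist :: "nat \<Rightarrow> ereal \<Rightarrow> point \<Rightarrow> point \<Rightarrow> real" where
  "lp_dist d p x y =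
    (if p = \<infinity> then (MAX i\<in>{..<d}. \<bar>x i - y i\<bar>)
     else (\<Sum>i<d. \<bar>x i - y i\<bar> powr real_of_ereal p) powr (1 / real_of_ereal p))"

definition lp_ball :: "nat \<Rightarrow> ereal \<Rightarrow> point \<Rightarrow> real \<Rightarrow> point set" where
  "lp_ball d p x r = {x' \<in> Rd d. lp_dist d p x x' \<le> r}"

(* A learned classifier need not be measurable, and even for a measurable classifier the
   robust error event is in general only analytic. The outer measure is the probability of
   every measurable event, and it does not assign 0 to non-measurable ones as emeasure does. *)
definition std_loss :: "example measure \<Rightarrow> classifier \<Rightarrow> ennreal" where
  "std_loss D f = outer_measure_of D {(x, y) \<in> space D. f x \<noteq> y}"

definition robust_loss ::
    "nat \<Rightarrow> ereal \<Rightarrow> real \<Rightarrow> example measure \<Rightarrow> classifier \<Rightarrow> ennreal" where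
  "robust_loss d p r D f =
    outer_measure_of D {(x, y) \<in> space D. \<exists>x'\<in>lp_ball d p x r. f x' \<noteq> y}"

definition expected_loss ::
    "(classifier \<Rightarrow> ennreal) \<Rightarrow> algorithm \<Rightarrow> example measure \<Rightarrow> nat \<Rightarrow> ennreal" where
  "expected_loss loss A D n =
    (\<integral>\<^sup>+ S. loss (A (map S [0..<n])) \<partial>(\<Pi>\<^sub>M i\<in>{..<n}. D))"

(* The infimum is a minimum, unless no sample size is good enough, when it is \<infinity>. *)
definition std_sample_complexity ::
    "real \<Rightarrow> algorithm \<Rightarrow> example measure \<Rightarrow> enat" where
  "std_sample_complexity \<epsilon> A D =
    (INF n\<in>{n. expected_loss (std_loss D) A D n \<le> ennreal \<epsilon>}. enat n)"

definition robust_sample_complexity ::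
    "nat \<Rightarrow> ereal \<Rightarrow> real \<Rightarrow> real \<Rightarrow> algorithm \<Rightarrow> example measure \<Rightarrow> enat" where
  "robust_sample_complexity d p r \<epsilon> A D =
    (INF n\<in>{n. expected_loss (robust_loss d p r D) A D n \<le> ennreal \<epsilon>}. enat n)"

definition linear_classifier :: "nat \<Rightarrow> point \<Rightarrow> real \<Rightarrow> classifier" where
  "linear_classifier d w b x \<longleftrightarrow> inner_d d w x \<ge> b"

definition boundary :: "nat \<Rightarrow> point \<Rightarrow> real \<Rightarrow> point set" where
  "boundary d w b = {x \<in> Rd d. inner_d d w x = b}"

(* For w = 0 and b \<noteq> 0 the boundary is empty and the distance is \<infinity>. *)
definition boundary_dist :: "nat \<Rightarrow> point \<Rightarrow> real \<Rightarrow> point \<Rightarrow> ereal" where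
  "boundary_dist d w b x = (INF z\<in>boundary d w b. ereal (l2_dist d x z))"

definition r_separated :: "nat \<Rightarrow> ereal \<Rightarrow> real \<Rightarrow> example measure \<Rightarrow> bool" where
  "r_separated d p r D \<longleftrightarrow>
    (\<exists>w\<in>Rd d. \<exists>b. robust_loss d p r D (linear_classifier d w b) = 0)"

definition labelled_support :: "nat \<Rightarrow> example measure \<Rightarrow> bool \<Rightarrow> point set" where
  "labelled_support d D y =
    {x \<in> Rd d. \<forall>e>0. emeasure D {(x', y') \<in> space D. l2_dist d x x' < e \<and> y' = y} > 0}"

definition support_points :: "nat \<Rightarrow> example measure \<Rightarrow> point set" where
  "support_points d D = labelled_support d D True \<union> labelled_support d D False"

definition attains_margin :: "nat \<Rightarrow> example measure \<Rightarrow> real \<Rightarrow> bool" where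
  "attains_margin d D \<gamma> \<longleftrightarrow>
    (\<exists>w\<in>Rd d. \<exists>b. std_loss D (linear_classifier d w b) = 0 \<and>
      (\<forall>x\<in>support_points d D. boundary_dist d w b x \<ge> ereal \<gamma>))"

definition has_margin :: "nat \<Rightarrow> example measure \<Rightarrow> bool" where
  "has_margin d D \<longleftrightarrow>
    (\<exists>\<gamma>. attains_margin d D \<gamma> \<and> (\<forall>\<gamma>'. attains_margin d D \<gamma>' \<longrightarrow> \<gamma>' \<le> \<gamma>))"

(* Meaningful only under has_margin. *)
definition margin :: "nat \<Rightarrow> example measure \<Rightarrow> real" where
  "margin d D = (GREATEST \<gamma>. attains_margin d D \<gamma>)"

definition diam2 :: "nat \<Rightarrow> point set \<Rightarrow> ereal" where
  "diam2 d X = (SUP x\<in>X. SUP y\<in>X. ereal (l2_dist d x y))"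

definition aspect_ratio :: "nat \<Rightarrow> example measure \<Rightarrow> ereal" where
  "aspect_ratio d D = diam2 d (support_points d D) / ereal (margin d D)"

(* A distribution for which no largest margin exists has no aspect ratio. This concerns
   distributions with only one label, where the margin is unbounded. *)
definition separated_family ::
    "nat \<Rightarrow> ereal \<Rightarrow> real \<Rightarrow> real \<Rightarrow> example measure set" where
  "separated_family d p r \<rho> =
    {D \<in> distributions d. r_separated d p r D \<and> has_margin d D \<and> aspect_ratio d D \<le> ereal \<rho>}"

definition separates_sample :: "nat \<Rightarrow> point \<Rightarrow> real \<Rightarrow> example list \<Rightarrow> bool" where
  "separates_sample d w b S \<longleftrightarrow> (\<forall>(x, y)\<in>set S. linear_classifier d w b x = y)"

definition sample_margin :: "nat \<Rightarrow> point \<Rightarrow> real \<Rightarrow> example list \<Rightarrow> ereal" where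
  "sample_margin d w b S = (INF (x, y)\<in>set S. boundary_dist d w b x)"

definition max_margin_classifier ::
    "nat \<Rightarrow> point \<Rightarrow> real \<Rightarrow> example list \<Rightarrow> bool" where
  "max_margin_classifier d w b S \<longleftrightarrow>
    w \<in> Rd d \<and> separates_sample d w b S \<and>
    (\<forall>w'\<in>Rd d. \<forall>b'. separates_sample d w' b' S \<longrightarrow>
      sample_margin d w' b' S \<le> sample_margin d w b S)"

(* M is unconstrained on samples that no linear classifier separates. On a nonempty sample
   with one label, the maximal margin is \<infinity>, attained exactly by w = 0 and b \<noteq> 0 of the
   right sign, so M returns the constant classifier (as the hard margin SVM program
   of minimizing the norm of w subject to y (<w,x> - b) \<ge> 1 does). *)
definition max_margin_algorithm :: "nat \<Rightarrow> algorithm \<Rightarrow> bool" where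
  "max_margin_algorithm d M \<longleftrightarrow>
    (\<forall>S. set S \<subseteq> Rd d \<times> UNIV \<and> (\<exists>w\<in>Rd d. \<exists>b. separates_sample d w b S) \<longrightarrow>
      (\<exists>w b. max_margin_classifier d w b S \<and> (\<forall>x\<in>Rd d. M S x = linear_classifier d w b x)))"

end

(* Lower bound. For each coordinate i the support contains a positive and a negative point on a line
   in direction (1,...,1), at l_p distance slightly more than 2r, whose position along the line is one
   of H unknown values; the remaining mass sits on one uninformative point. Every choice of positions
   is linearly r-separable: because p > 1, the dual norm is differentiable at the all-ones normal, so
   tilting the normal to follow the positions costs only a second-order term. But for two different
   positions some ball around a positive point meets a ball around a negative one, so whatever
   classifier is learned, a pair that was not sampled is handled robustly for at most one of the H
   positions. Averaging over all positions and over all sample sizes below d/epsilon, with H large,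
   gives one distribution that is bad for all these sample sizes simultaneously.

   Upper bound. For a sample S let V(S) be the least squared norm of a normal vector separating S with
   unit functional margin. A mistake of the max margin classifier on a new point raises V by at least
   1/diam^2, while V never exceeds 1/margin^2. Hence the expected losses at the sample sizes
   1, ..., n add up to at most rho^2, and one of them is at most rho^2/n. *)

theory Submission
  imports Defs
begin

subsection \<open>Linear classifiers and their margins\<close>

text \<open>The lower bound compares orders in a small parameter \<kappa>. The two points of a pair
  are farther apart than 2r by 2r\<kappa>, which is also the step between neighbouring positions, so
  one step of difference uses up the excess and makes two positions incompatible. Tilting raises the
  dual norm only by o(\<kappa>), so a slack of order \<kappa> pays for it once \<kappa> is small in
  terms of d, p and H. For p = 1 the dual norm is the maximum norm, which has a corner at the
  all-ones vector, and tilting would itself cost a term of order \<kappa>. Each pair is displaced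
  along its own coordinate axis by an amount comparable to its Euclidean extent. Hence coordinate i
  of the normal can be adjusted to pair i, and the aspect ratio is at most 16 in every dimension. A
  learning algorithm is an arbitrary map, so its loss need not be measurable in the sample and the
  expected loss is a lower integral. Both halves use it only in the direction that survives:
  superadditivity for the potential, a simple minorant for the hard distributions.\<close>

abbreviation norm_d :: "nat \<Rightarrow> point \<Rightarrow> real" where
  "norm_d d w \<equiv> L2_set w {..<d}"

lemma inner_d_add_scaled:
  "inner_d d (\<lambda>i. a * u i + b * v i) x = a * inner_d d u x + b * inner_d d v x"
  unfolding inner_d_def by (simp add: sum.distrib sum_distrib_left algebra_simps)

lemma inner_d_add_scaled_right:
  "inner_d d w (\<lambda>i. a * x i + b * y i) = a * inner_d d w x + b * inner_d d w y"
  unfolding inner_d_def by (simp add: sum.distrib sum_distrib_left algebra_simps)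

lemma inner_d_scale: "inner_d d (\<lambda>i. a * w i) x = a * inner_d d w x"
  using inner_d_add_scaled[of d a w 0 w x] by simp

lemma inner_d_diff: "inner_d d (\<lambda>i. u i - v i) x = inner_d d u x - inner_d d v x"
  using inner_d_add_scaled[of d 1 u "-1" v x] by simp

lemma inner_d_diff_right: "inner_d d w (\<lambda>i. x i - y i) = inner_d d w x - inner_d d w y"
  using inner_d_add_scaled_right[of d w 1 x "-1" y] by simp

lemma inner_d_cong:
  assumes "\<And>i. i < d \<Longrightarrow> w i = w' i" "\<And>i. i < d \<Longrightarrow> x i = x' i"
  shows "inner_d d w x = inner_d d w' x'"
  unfolding inner_d_def using assms by (intro sum.cong) auto

lemma inner_d_restrict [simp]: "inner_d d (restrict w {..<d}) x = inner_d d w x"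
  by (rule inner_d_cong) auto

lemma inner_d_restrict_right [simp]: "inner_d d w (restrict x {..<d}) = inner_d d w x"
  by (rule inner_d_cong) auto

lemma inner_d_commute: "inner_d d w x = inner_d d x w"
  by (simp add: inner_d_def mult.commute)

lemma norm_d_restrict [simp]: "norm_d d (restrict w {..<d}) = norm_d d w"
  by (rule L2_set_cong) auto

lemma norm_d_square: "(norm_d d w)\<^sup>2 = inner_d d w w"
  unfolding L2_set_def inner_d_def by (simp add: sum_nonneg power2_eq_square)

lemma norm_d_scale: "norm_d d (\<lambda>i. a * w i) = \<bar>a\<bar> * norm_d d w"
  unfolding L2_set_def by (simp add: power_mult_distrib real_sqrt_mult flip: sum_distrib_left)

lemma inner_d_le_norm: "\<bar>inner_d d w x\<bar> \<le> norm_d d w * norm_d d x"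
proof -
  have "\<bar>inner_d d w x\<bar> \<le> (\<Sum>i<d. \<bar>w i\<bar> * \<bar>x i\<bar>)"
    unfolding inner_d_def by (rule order_trans[OF sum_abs]) (simp add: abs_mult)
  then show ?thesis using L2_set_mult_ineq[of w x "{..<d}"] by linarith
qed

lemma inner_d_zero_norm: "norm_d d w = 0 \<Longrightarrow> inner_d d w x = 0"
  using inner_d_le_norm[of d w x] by simp

lemma inner_d_dist_le: "\<bar>inner_d d w x - inner_d d w y\<bar> \<le> norm_d d w * l2_dist d x y"
  unfolding l2_dist_def inner_d_diff_right[symmetric] by (rule inner_d_le_norm)

text \<open>The foot of the perpendicular from x lies on the boundary at this distance, and by
  Cauchy-Schwarz no boundary point is closer.\<close>

lemma boundary_dist_eq:
  assumes "x \<in> Rd d" "norm_d d w > 0"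
  shows "boundary_dist d w b x = ereal (\<bar>inner_d d w x - b\<bar> / norm_d d w)"
proof (rule antisym)
  define c where "c = (inner_d d w x - b) / (norm_d d w)\<^sup>2"
  define z where "z = restrict (\<lambda>i. 1 * x i + (- c) * w i) {..<d}"
  have "inner_d d w z = inner_d d w x - c * (norm_d d w)\<^sup>2"
    unfolding z_def inner_d_restrict_right inner_d_add_scaled_right norm_d_square by simp
  also have "\<dots> = b" using assms(2) by (simp add: c_def)
  finally have "z \<in> boundary d w b" by (simp add: boundary_def z_def)
  then have "boundary_dist d w b x \<le> ereal (l2_dist d x z)"
    unfolding boundary_dist_def by (rule INF_lower)
  also have "l2_dist d x z = norm_d d (\<lambda>i. c * w i)"
    unfolding l2_dist_def z_def by (rule L2_set_cong) auto
  also have "\<dots> = \<bar>inner_d d w x - b\<bar> / norm_d d w"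
    unfolding norm_d_scale c_def using assms(2) by (simp add: abs_divide power2_eq_square)
  finally show "boundary_dist d w b x \<le> ereal (\<bar>inner_d d w x - b\<bar> / norm_d d w)" .
next
  show "ereal (\<bar>inner_d d w x - b\<bar> / norm_d d w) \<le> boundary_dist d w b x"
    unfolding boundary_dist_def
  proof (rule INF_greatest)
    fix z assume "z \<in> boundary d w b"
    then have "inner_d d w z = b" by (simp add: boundary_def)
    then have "\<bar>inner_d d w x - b\<bar> \<le> norm_d d w * l2_dist d x z"
      using inner_d_dist_le[of d w x z] by simp
    then show "ereal (\<bar>inner_d d w x - b\<bar> / norm_d d w) \<le> ereal (l2_dist d x z)"
      using assms(2) by (simp add: divide_le_eq mult.commute)
  qed
qed

lemma boundary_dist_zero_normal:
  assumes "norm_d d w = 0" "b \<noteq> 0"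
  shows "boundary_dist d w b x = \<infinity>"
proof -
  have "boundary d w b = {}"
    using assms by (auto simp: boundary_def inner_d_zero_norm)
  then show ?thesis by (simp add: boundary_dist_def top_ereal_def)
qed

section \<open>Measurability of the errors of linear classifiers\<close>

lemma space_example_space: "space (example_space d) = Rd d \<times> UNIV"
  by (simp add: example_space_def space_pair_measure space_PiM)

lemma distributions_space: "D \<in> distributions d \<Longrightarrow> space D = Rd d \<times> UNIV"
  unfolding distributions_def space_example_space[symmetric]
  by (auto dest: sets_eq_imp_space_eq)

lemma distributions_prob_space: "D \<in> distributions d \<Longrightarrow> prob_space D"
  by (simp add: distributions_def)

lemma distributions_measurable_cong:
  "D \<in> distributions d \<Longrightarrow> measurable D N = measurable (example_space d) N"
  by (rule measurable_cong_sets) (auto simp: distributions_def)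

lemma measurable_coordinate:
  assumes "D \<in> distributions d"
  shows "(\<lambda>z. fst z i) \<in> borel_measurable D"
proof (cases "i < d")
  case True
  then have [measurable]: "i \<in> {..<d}" by simp
  have "(\<lambda>z. fst z i) \<in> borel_measurable (example_space d)"
    unfolding example_space_def by measurable
  then show ?thesis using assms by (simp add: distributions_measurable_cong)
next
  case False
  \<comment> \<open>Points of \<open>Rd d\<close> are extended by \<open>undefined\<close>, so a
    coordinate beyond d is constant on the space.\<close>
  have "(\<lambda>z. fst z i) \<in> borel_measurable D \<longleftrightarrow> (\<lambda>z. undefined :: real) \<in> borel_measurable D"
    using False by (intro measurable_cong) (auto simp: distributions_space[OF assms] PiE_def extensional_def)
  then show ?thesis by simp
qed

lemma measurable_label:
  assumes "D \<in> distributions d"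
  shows "snd \<in> measurable D (count_space UNIV)"
  unfolding distributions_measurable_cong[OF assms] example_space_def by measurable

lemma measurable_inner_d:
  assumes "D \<in> distributions d"
  shows "(\<lambda>z. inner_d d w (fst z)) \<in> borel_measurable D"
  unfolding inner_d_def using measurable_coordinate[OF assms] by (intro borel_measurable_sum borel_measurable_times) auto

lemma sets_linear_error:
  assumes "D \<in> distributions d"
  shows "{(x, y) \<in> space D. linear_classifier d w b x \<noteq> y} \<in> sets D"
proof -
  note [measurable] = measurable_inner_d[OF assms] measurable_label[OF assms]
  have "{z \<in> space D. (b \<le> inner_d d w (fst z)) \<noteq> snd z} \<in> sets D" by measurable
  also have "{z \<in> space D. (b \<le> inner_d d w (fst z)) \<noteq> snd z} =
      {(x, y) \<in> space D. linear_classifier d w b x \<noteq> y}"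
    by (auto simp: linear_classifier_def)
  finally show ?thesis .
qed

lemma std_loss_linear_zero_iff:
  assumes "D \<in> distributions d"
  shows "std_loss D (linear_classifier d w b) = 0 \<longleftrightarrow>
    (AE z in D. linear_classifier d w b (fst z) = snd z)"
proof -
  have "(AE z in D. linear_classifier d w b (fst z) = snd z) \<longleftrightarrow>
     emeasure D {(x, y) \<in> space D. linear_classifier d w b x \<noteq> y} = 0"
    by (rule AE_iff_measurable[OF sets_linear_error[OF assms]]) auto
  then show ?thesis unfolding std_loss_def using sets_linear_error[OF assms] by simp
qed

subsection \<open>Mistakes of the max margin classifier\<close>

definition label_sign :: "bool \<Rightarrow> real" where
  "label_sign y = (if y then 1 else - 1)"

definition unit_margin :: "nat \<Rightarrow> point \<Rightarrow> real \<Rightarrow> example set \<Rightarrow> bool" where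
  "unit_margin d w b X \<longleftrightarrow> (\<forall>(x, y)\<in>X. label_sign y * (inner_d d w x - b) \<ge> 1)"

definition strict_unit_margin :: "nat \<Rightarrow> point \<Rightarrow> real \<Rightarrow> example set \<Rightarrow> bool" where
  "strict_unit_margin d w b X \<longleftrightarrow> (\<forall>(x, y)\<in>X. label_sign y * (inner_d d w x - b) > 1)"

text \<open>The strict inequalities do not change the infimum, but they make its sublevel sets open in the
  coordinates of the sample, hence measurable.\<close>

definition svm_cost :: "nat \<Rightarrow> example set \<Rightarrow> ennreal" where
  "svm_cost d X = (INF (w, b)\<in>{(w, b). strict_unit_margin d w b X}. ennreal ((norm_d d w)\<^sup>2))"

lemma label_sign_simps [simp]: "label_sign True = 1" "label_sign False = - 1"
  by (simp_all add: label_sign_def)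

lemma unit_marginD:
  assumes "unit_margin d w b X"
  shows "(x, True) \<in> X \<Longrightarrow> inner_d d w x \<ge> b + 1" "(x, False) \<in> X \<Longrightarrow> inner_d d w x \<le> b - 1"
  using assms by (force simp: unit_margin_def)+

lemma unit_marginI:
  assumes "\<And>x. (x, True) \<in> X \<Longrightarrow> inner_d d w x \<ge> b + 1" "\<And>x. (x, False) \<in> X \<Longrightarrow> inner_d d w x \<le> b - 1"
  shows "unit_margin d w b X"
  unfolding unit_margin_def
proof safe
  fix x y assume "(x, y) \<in> X"
  then show "1 \<le> label_sign y * (inner_d d w x - b)"
    by (cases y) (use assms[of x] in auto)
qed

lemma strict_unit_margin_imp: "strict_unit_margin d w b X \<Longrightarrow> unit_margin d w b X"
  by (force simp: strict_unit_margin_def unit_margin_def)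

lemma svm_cost_le_strict:
  assumes "strict_unit_margin d w b X"
  shows "svm_cost d X \<le> ennreal ((norm_d d w)\<^sup>2)"
  unfolding svm_cost_def using assms by (intro INF_lower2[of "(w, b)"]) auto

lemma svm_cost_greatest:
  assumes "\<And>w b. strict_unit_margin d w b X \<Longrightarrow> c \<le> ennreal ((norm_d d w)\<^sup>2)"
  shows "c \<le> svm_cost d X"
  unfolding svm_cost_def using assms by (intro INF_greatest) auto

lemma svm_cost_mono: "X \<subseteq> Y \<Longrightarrow> svm_cost d X \<le> svm_cost d Y"
  by (intro svm_cost_greatest svm_cost_le_strict) (auto simp: strict_unit_margin_def)

text \<open>Scaling (w, b) by 1 + \<eta> turns the weak margin into a strict one, and the squared
  norm is continuous as \<eta> tends to 0.\<close>

lemma svm_cost_le: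
  assumes "unit_margin d w b X"
  shows "svm_cost d X \<le> ennreal ((norm_d d w)\<^sup>2)"
proof -
  have "((\<lambda>\<eta>. ennreal ((norm_d d (\<lambda>i. (1 + \<eta>) * w i))\<^sup>2)) \<longlongrightarrow> ennreal (((1 + 0) * norm_d d w)\<^sup>2))
      (at_right 0)"
    unfolding norm_d_scale power_mult_distrib power2_abs by (intro tendsto_intros)
  moreover have "\<forall>\<^sub>F \<eta> in at_right 0. svm_cost d X \<le> ennreal ((norm_d d (\<lambda>i. (1 + \<eta>) * w i))\<^sup>2)"
    unfolding eventually_at_right_field
  proof (intro exI[of _ 1] conjI allI impI)
    fix \<eta> :: real assume "0 < \<eta>" "\<eta> < 1"
    have "strict_unit_margin d (\<lambda>i. (1 + \<eta>) * w i) ((1 + \<eta>) * b) X"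
      unfolding strict_unit_margin_def
    proof safe
      fix x y assume "(x, y) \<in> X"
      then have "1 \<le> label_sign y * (inner_d d w x - b)"
        using assms by (auto simp: unit_margin_def)
      then have "(1 + \<eta>) * 1 \<le> (1 + \<eta>) * (label_sign y * (inner_d d w x - b))"
        using \<open>0 < \<eta>\<close> by (intro mult_left_mono) auto
      then show "1 < label_sign y * (inner_d d (\<lambda>i. (1 + \<eta>) * w i) x - (1 + \<eta>) * b)"
        using \<open>0 < \<eta>\<close> unfolding inner_d_scale by (simp add: algebra_simps)
    qed
    then show "svm_cost d X \<le> ennreal ((norm_d d (\<lambda>i. (1 + \<eta>) * w i))\<^sup>2)"
      by (rule svm_cost_le_strict)
  qed simp
  ultimately have "svm_cost d X \<le> ennreal (((1 + 0) * norm_d d w)\<^sup>2)"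
    by (rule tendsto_lowerbound) simp
  then show ?thesis by simp
qed

section \<open>Normal form of the max margin classifier\<close>

lemma sample_margin_ge:
  assumes "norm_d d w > 0" "set S \<subseteq> Rd d \<times> UNIV"
    and "\<And>x y. (x, y) \<in> set S \<Longrightarrow> \<gamma> * norm_d d w \<le> \<bar>inner_d d w x - b\<bar>"
  shows "ereal \<gamma> \<le> sample_margin d w b S"
  unfolding sample_margin_def
proof (intro INF_greatest, clarify)
  fix x y assume "(x, y) \<in> set S"
  with assms show "ereal \<gamma> \<le> boundary_dist d w b x"
    by (subst boundary_dist_eq) (auto simp: le_divide_eq)
qed

lemma sample_margin_le:
  assumes "(x, y) \<in> set S" "x \<in> Rd d" "norm_d d w > 0"
  shows "sample_margin d w b S \<le> ereal (\<bar>inner_d d w x - b\<bar> / norm_d d w)"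
  unfolding sample_margin_def boundary_dist_eq[OF assms(2,3), symmetric]
  by (rule INF_lower2[OF assms(1)]) simp

lemma unit_margin_norm_pos:
  assumes "unit_margin d w b X" "(x, True) \<in> X" "(x', False) \<in> X"
  shows "norm_d d w > 0"
proof (rule ccontr)
  assume "\<not> norm_d d w > 0"
  then have "norm_d d w = 0" using L2_set_nonneg[of w "{..<d}"] by linarith
  then show False
    using unit_marginD(1)[OF assms(1,2)] unit_marginD(2)[OF assms(1,3)]
    by (simp add: inner_d_zero_norm)
qed

text \<open>Moving the threshold to the middle of the gap between the lowest positive and the
  highest negative inner product gives margin \<open>h / norm_d d w\<^sub>0\<close>, so maximality
  forces \<open>b\<^sub>0\<close> to be that middle already. Dividing by \<open>h\<close> makes the
  functional margin 1, with equality at the support vectors p and q. A competitor w with unit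
  functional margin has geometric margin at least 1 / |w|, which cannot beat the maximum; hence u
  has least norm.\<close>

lemma max_margin_normal_form:
  assumes mm: "max_margin_classifier d w\<^sub>0 b\<^sub>0 S" and S: "set S \<subseteq> Rd d \<times> UNIV"
    and pos: "(x\<^sub>1, True) \<in> set S" and neg: "(x\<^sub>2, False) \<in> set S"
  obtains u \<beta> p q where
    "\<And>x. linear_classifier d w\<^sub>0 b\<^sub>0 x \<longleftrightarrow> inner_d d u x \<ge> \<beta>"
    "unit_margin d u \<beta> (set S)"
    "(p, True) \<in> set S" "inner_d d u p = \<beta> + 1" "(q, False) \<in> set S" "inner_d d u q = \<beta> - 1"
    "\<And>w b. unit_margin d w b (set S) \<Longrightarrow> norm_d d u \<le> norm_d d w"
proof -
  define P where "P = {x. (x, True) \<in> set S}"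
  define Q where "Q = {x. (x, False) \<in> set S}"
  have fin: "finite P" "finite Q"
    by (rule finite_subset[of _ "fst ` set S"]; force simp: P_def Q_def)+
  have ne: "P \<noteq> {}" "Q \<noteq> {}" using pos neg by (auto simp: P_def Q_def)
  obtain p where p: "p \<in> P" "\<And>x. x \<in> P \<Longrightarrow> inner_d d w\<^sub>0 p \<le> inner_d d w\<^sub>0 x"
    using ex_is_arg_min_if_finite[OF fin(1) ne(1), of "inner_d d w\<^sub>0"]
    by (auto simp: is_arg_min_linorder)
  obtain q where q: "q \<in> Q" "\<And>x. x \<in> Q \<Longrightarrow> inner_d d w\<^sub>0 x \<le> inner_d d w\<^sub>0 q"
    using ex_is_arg_min_if_finite[OF fin(2) ne(2), of "\<lambda>x. - inner_d d w\<^sub>0 x"]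
    by (auto simp: is_arg_min_linorder)
  have inRd: "x \<in> Rd d" if "(x, y) \<in> set S" for x y using that S by auto
  have pS: "(p, True) \<in> set S" and qS: "(q, False) \<in> set S"
    using p(1) q(1) by (auto simp: P_def Q_def)
  have sep: "separates_sample d w\<^sub>0 b\<^sub>0 S" using mm by (simp add: max_margin_classifier_def)
  have pb: "b\<^sub>0 \<le> inner_d d w\<^sub>0 p" and qb: "inner_d d w\<^sub>0 q < b\<^sub>0"
    using sep pS qS by (force simp: separates_sample_def linear_classifier_def)+
  define h where "h = (inner_d d w\<^sub>0 p - inner_d d w\<^sub>0 q) / 2"
  have h: "h > 0" using pb qb by (simp add: h_def)
  define m where "m = (inner_d d w\<^sub>0 p + inner_d d w\<^sub>0 q) / 2"
  have nz: "norm_d d w\<^sub>0 > 0"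
  proof (rule ccontr)
    assume "\<not> norm_d d w\<^sub>0 > 0"
    then have "norm_d d w\<^sub>0 = 0" using L2_set_nonneg[of w\<^sub>0 "{..<d}"] by linarith
    then show False using pb qb by (simp add: inner_d_zero_norm)
  qed
  have mpos: "inner_d d w\<^sub>0 x \<ge> m + h" if "(x, True) \<in> set S" for x
    using p(2)[of x] that by (simp add: P_def m_def h_def field_simps)
  have mneg: "inner_d d w\<^sub>0 x \<le> m - h" if "(x, False) \<in> set S" for x
    using q(2)[of x] that by (simp add: Q_def m_def h_def field_simps)
  have best: "sample_margin d w b S \<le> sample_margin d w\<^sub>0 b\<^sub>0 S"
    if "w \<in> Rd d" "separates_sample d w b S" for w b
    using mm that by (simp add: max_margin_classifier_def)
  have "separates_sample d w\<^sub>0 m S"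
    unfolding separates_sample_def
  proof (clarify)
    fix x y assume "(x, y) \<in> set S"
    then show "linear_classifier d w\<^sub>0 m x = y"
      using mpos[of x] mneg[of x] h by (cases y) (auto simp: linear_classifier_def)
  qed
  then have "sample_margin d w\<^sub>0 m S \<le> sample_margin d w\<^sub>0 b\<^sub>0 S"
    using mm by (intro best) (auto simp: max_margin_classifier_def)
  moreover have "ereal (h / norm_d d w\<^sub>0) \<le> sample_margin d w\<^sub>0 m S"
  proof (rule sample_margin_ge[OF nz S])
    fix x y assume "(x, y) \<in> set S"
    then show "h / norm_d d w\<^sub>0 * norm_d d w\<^sub>0 \<le> \<bar>inner_d d w\<^sub>0 x - m\<bar>"
      using mpos[of x] mneg[of x] h nz by (cases y) auto
  qed
  ultimately have *: "ereal (h / norm_d d w\<^sub>0) \<le> sample_margin d w\<^sub>0 b\<^sub>0 S" by simp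
  have "h / norm_d d w\<^sub>0 \<le> \<bar>inner_d d w\<^sub>0 x - b\<^sub>0\<bar> / norm_d d w\<^sub>0" if "(x, y) \<in> set S" for x y
    using order_trans[OF * sample_margin_le[OF that inRd[OF that] nz]] by simp
  then have hle: "h \<le> \<bar>inner_d d w\<^sub>0 x - b\<^sub>0\<bar>" if "(x, y) \<in> set S" for x y
    using that nz by (meson divide_le_cancel less_asym)
  \<comment> \<open>The gap has length 2h, so a threshold inside it at distance at least h from both
    ends is the midpoint.\<close>
  have b0: "b\<^sub>0 = m"
    using hle[OF pS] hle[OF qS] pb qb by (simp add: h_def m_def abs_if field_simps split: if_splits)
  have up: "sample_margin d w\<^sub>0 b\<^sub>0 S \<le> ereal (h / norm_d d w\<^sub>0)"
    using sample_margin_le[OF pS inRd[OF pS] nz, of b\<^sub>0] h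
    by (simp add: b0 m_def h_def field_simps)
  define u where "u = (\<lambda>i. 1 / h * w\<^sub>0 i)"
  have iu: "inner_d d u x = inner_d d w\<^sub>0 x / h" for x
    unfolding u_def inner_d_scale by simp
  have nu: "norm_d d u = norm_d d w\<^sub>0 / h" unfolding u_def norm_d_scale using h by simp
  show thesis
  proof (rule that[of "m / h" u p q])
    show "linear_classifier d w\<^sub>0 b\<^sub>0 x \<longleftrightarrow> inner_d d u x \<ge> m / h" for x
      using h by (simp add: linear_classifier_def b0 iu divide_le_cancel)
    show "unit_margin d u (m / h) (set S)"
    proof (rule unit_marginI)
      have e: "m / h + 1 = (m + h) / h" "m / h - 1 = (m - h) / h"
        using h by (simp_all add: field_simps)
      show "inner_d d u x \<ge> m / h + 1" if "(x, True) \<in> set S" for x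
        unfolding iu e using mpos[OF that] h by (intro divide_right_mono) auto
      show "inner_d d u x \<le> m / h - 1" if "(x, False) \<in> set S" for x
        unfolding iu e using mneg[OF that] h by (intro divide_right_mono) auto
    qed
    show "inner_d d u p = m / h + 1" "inner_d d u q = m / h - 1"
      using h unfolding iu by (simp_all add: m_def field_simps) (simp_all add: h_def field_simps)
    fix w b assume um: "unit_margin d w b (set S)"
    have nw: "norm_d d w > 0" by (rule unit_margin_norm_pos[OF um pS qS])
    have "separates_sample d (restrict w {..<d}) b S"
      unfolding separates_sample_def
    proof (clarify)
      fix x y assume "(x, y) \<in> set S"
      then show "linear_classifier d (restrict w {..<d}) b x = y"
        using unit_marginD[OF um, of x] by (cases y) (auto simp: linear_classifier_def)
    qed
    then have "sample_margin d (restrict w {..<d}) b S \<le> ereal (h / norm_d d w\<^sub>0)"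
      by (intro order_trans[OF best up]) auto
    moreover have "ereal (1 / norm_d d w) \<le> sample_margin d (restrict w {..<d}) b S"
    proof (rule sample_margin_ge)
      fix x y assume "(x, y) \<in> set S"
      then show "1 / norm_d d w * norm_d d (restrict w {..<d}) \<le> \<bar>inner_d d (restrict w {..<d}) x - b\<bar>"
        using unit_marginD[OF um, of x] nw by (cases y) auto
    qed (use nw S in auto)
    ultimately have "1 / norm_d d w \<le> h / norm_d d w\<^sub>0"
      by (metis ereal_less_eq(3) order_trans)
    then show "norm_d d u \<le> norm_d d w"
      using h nw nz by (simp add: nu field_simps)
  qed (use pS qS in auto)
qed

text \<open>The pairs with unit margin form a convex set, so the segment from u to w stays
  admissible. Since the norm cannot fall when u is left in the direction w - u, the inner product of
  u with w - u is nonnegative (\<open>e\<close> is its negative), and expanding |u + (w - u)|^2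
  gives the claim.\<close>

lemma minimal_norm_pythagoras:
  assumes u: "unit_margin d u \<beta> X" and w: "unit_margin d w b X"
    and min: "\<And>w b. unit_margin d w b X \<Longrightarrow> norm_d d u \<le> norm_d d w"
  shows "(norm_d d u)\<^sup>2 + (norm_d d (\<lambda>i. w i - u i))\<^sup>2 \<le> (norm_d d w)\<^sup>2"
proof -
  define K where "K = (norm_d d (\<lambda>i. w i - u i))\<^sup>2"
  define e where "e = inner_d d u u - inner_d d u w"
  have K: "K = inner_d d w w - 2 * inner_d d u w + inner_d d u u"
    unfolding K_def norm_d_square
    by (simp add: inner_d_diff inner_d_diff_right inner_d_commute)
  \<comment> \<open>This is |u|^2 \<le> |u + s (w - u)|^2, expanded and divided by s.\<close>
  have seg: "2 * e \<le> s * K" if s: "0 < s" "s \<le> 1" for s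
  proof -
    define v where "v = (\<lambda>i. (1 - s) * u i + s * w i)"
    have "unit_margin d v ((1 - s) * \<beta> + s * b) X"
      unfolding unit_margin_def
    proof clarify
      fix x y assume xy: "(x, y) \<in> X"
      have "1 = (1 - s) * 1 + s * 1" by simp
      also have "\<dots> \<le> (1 - s) * (label_sign y * (inner_d d u x - \<beta>)) + s * (label_sign y * (inner_d d w x - b))"
        using xy u w s by (intro add_mono mult_left_mono) (auto simp: unit_margin_def)
      finally show "1 \<le> label_sign y * (inner_d d v x - ((1 - s) * \<beta> + s * b))"
        unfolding v_def inner_d_add_scaled by (simp add: algebra_simps)
    qed
    then have "(norm_d d u)\<^sup>2 \<le> (norm_d d v)\<^sup>2"
      by (intro power_mono min L2_set_nonneg)
    also have "(norm_d d v)\<^sup>2 = (1 - s)\<^sup>2 * inner_d d u u + 2 * s * (1 - s) * inner_d d u w + s\<^sup>2 * inner_d d w w"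
      unfolding norm_d_square v_def inner_d_add_scaled inner_d_add_scaled_right
      by (simp add: inner_d_commute[of d w u] algebra_simps power2_eq_square)
    finally have "0 \<le> s * (s * K - 2 * e)"
      unfolding norm_d_square K e_def by (simp add: algebra_simps power2_eq_square)
    then show ?thesis using s by (simp add: zero_le_mult_iff)
  qed
  have "e \<le> 0"
  proof (rule ccontr)
    assume "\<not> e \<le> 0"
    then have "e > 0" "K \<ge> 2 * e" using seg[of 1] by auto
    \<comment> \<open>The choice s = e / K is admissible because s = 1 already gave K \<ge> 2e; it
      yields 2e \<le> e.\<close>
    then have "2 * e \<le> e / K * K" by (intro seg) (auto simp: divide_le_eq)
    then show False using \<open>e > 0\<close> \<open>K \<ge> 2 * e\<close> by simp
  qed
  then show ?thesis unfolding K_def[symmetric] unfolding norm_d_square K e_def by linarith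
qed

text \<open>Cauchy-Schwarz. It is applied to the difference of two normals when the sample has both
  labels, and to the normal itself when the sample has only one.\<close>

lemma separated_norm_bound:
  assumes "inner_d d v x - inner_d d v x' \<ge> 1 \<or> inner_d d v x' - inner_d d v x \<ge> 1"
    and "l2_dist d x x' \<le> \<Delta>" "0 < \<Delta>"
  shows "1 / \<Delta>\<^sup>2 \<le> (norm_d d v)\<^sup>2"
proof -
  have "1 \<le> norm_d d v * l2_dist d x x'"
    using inner_d_dist_le[of d v x x'] assms(1) by linarith
  also have "\<dots> \<le> norm_d d v * \<Delta>" by (intro mult_left_mono assms(2) L2_set_nonneg)
  finally have "1 / \<Delta> \<le> norm_d d v" using assms(3) by (simp add: divide_le_eq)
  then have "(1 / \<Delta>)\<^sup>2 \<le> (norm_d d v)\<^sup>2" using assms(3) by (intro power_mono) auto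
  then show ?thesis by (simp add: power_divide)
qed

lemma hd_single_label:
  assumes "S \<noteq> []" "\<And>x y. (x, y) \<in> set S \<Longrightarrow> y = y\<^sub>0"
  shows "(fst (hd S), y\<^sub>0) \<in> set S"
proof -
  have *: "(fst (hd S), snd (hd S)) \<in> set S" using assms(1) by simp
  then have "snd (hd S) = y\<^sub>0" by (rule assms(2))
  with * show ?thesis by simp
qed

text \<open>The zero normal with a nonzero threshold of the right sign has empty boundary and hence
  infinite margin. Maximality then requires infinite distances, which a nonzero normal cannot
  provide, so the learned classifier is constant and takes the label of the sample.\<close>

lemma max_margin_single_label:
  assumes mm: "max_margin_classifier d w\<^sub>0 b\<^sub>0 S" and S: "set S \<subseteq> Rd d \<times> UNIV" "S \<noteq> []"
    and single: "\<And>x y. (x, y) \<in> set S \<Longrightarrow> y = y\<^sub>0"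
  shows "linear_classifier d w\<^sub>0 b\<^sub>0 x = y\<^sub>0"
proof -
  define x\<^sub>1 where "x\<^sub>1 = fst (hd S)"
  have x1: "(x\<^sub>1, y\<^sub>0) \<in> set S"
    unfolding x\<^sub>1_def by (rule hd_single_label[OF S(2)]) (rule single)
  then have x1d: "x\<^sub>1 \<in> Rd d" using S by auto
  define b where "b = - label_sign y\<^sub>0"
  define w where "w = restrict (\<lambda>i. 0 :: real) {..<d}"
  have w: "w \<in> Rd d" "norm_d d w = 0" "inner_d d w x = 0" for x
    by (auto simp: w_def L2_set_def inner_d_def)
  have "separates_sample d w b S"
    using single w by (auto simp: separates_sample_def linear_classifier_def b_def label_sign_def split: if_splits)
  then have "sample_margin d w b S \<le> sample_margin d w\<^sub>0 b\<^sub>0 S"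
    using mm w by (simp add: max_margin_classifier_def)
  moreover have "sample_margin d w b S = \<infinity>"
    unfolding sample_margin_def using w
    by (subst INF_cong[OF refl, of _ _ "\<lambda>_. \<infinity>"])
       (auto simp: boundary_dist_zero_normal b_def label_sign_def, use S(2) in auto)
  moreover have "sample_margin d w\<^sub>0 b\<^sub>0 S \<le> boundary_dist d w\<^sub>0 b\<^sub>0 x\<^sub>1"
    unfolding sample_margin_def by (rule INF_lower2[OF x1]) simp
  ultimately have inf: "boundary_dist d w\<^sub>0 b\<^sub>0 x\<^sub>1 = \<infinity>" by auto
  then have "\<not> norm_d d w\<^sub>0 > 0" using boundary_dist_eq[OF x1d, of w\<^sub>0 b\<^sub>0] by auto
  then have "norm_d d w\<^sub>0 = 0" using L2_set_nonneg[of w\<^sub>0 "{..<d}"] by linarith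
  then have "linear_classifier d w\<^sub>0 b\<^sub>0 x = linear_classifier d w\<^sub>0 b\<^sub>0 x\<^sub>1"
    by (simp add: linear_classifier_def inner_d_zero_norm)
  also have "\<dots> = y\<^sub>0"
    using mm x1 by (auto simp: max_margin_classifier_def separates_sample_def)
  finally show ?thesis .
qed

lemma svm_cost_single_label:
  assumes "\<And>x y. (x, y) \<in> X \<Longrightarrow> y = y\<^sub>0"
  shows "svm_cost d X = 0"
proof -
  have "unit_margin d (\<lambda>_. 0) (- label_sign y\<^sub>0) X"
    by (rule unit_marginI) (use assms in \<open>auto simp: inner_d_def\<close>)
  from svm_cost_le[OF this] show ?thesis by (simp add: L2_set_def)
qed

text \<open>The potential argument behind the mistake bound: the hyperplane \<open>(u, \<beta>)\<close> has minimal norm among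
  those with unit margin on \<open>S\<close>, so any hyperplane with unit margin on the enlarged sample gains the
  squared length of its difference to \<open>u\<close>; and a mistake forces this difference to be large.\<close>

lemma svm_cost_mistake:
  assumes mm: "max_margin_classifier d w\<^sub>0 b\<^sub>0 S" and S: "set S \<subseteq> Rd d \<times> UNIV" "S \<noteq> []"
    and mistake: "linear_classifier d w\<^sub>0 b\<^sub>0 x \<noteq> y"
    and dist: "\<And>x' y'. (x', y') \<in> set S \<Longrightarrow> l2_dist d x x' \<le> \<Delta>" and \<Delta>: "0 < \<Delta>"
  shows "svm_cost d (set S) + ennreal (1 / \<Delta>\<^sup>2) \<le> svm_cost d (insert (x, y) (set S))"
proof (cases "\<exists>y\<^sub>0. \<forall>x y. (x, y) \<in> set S \<longrightarrow> y = y\<^sub>0")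
  case True
  then obtain y\<^sub>0 where y0: "\<And>x y. (x, y) \<in> set S \<Longrightarrow> y = y\<^sub>0" by blast
  define x\<^sub>1 where "x\<^sub>1 = fst (hd S)"
  have x1: "(x\<^sub>1, y\<^sub>0) \<in> set S"
    unfolding x\<^sub>1_def by (rule hd_single_label[OF S(2)]) (rule y0)
  have y: "y = (\<not> y\<^sub>0)"
    using mistake max_margin_single_label[OF mm S y0] by auto
  have "ennreal (1 / \<Delta>\<^sup>2) \<le> svm_cost d (insert (x, y) (set S))"
  proof (intro svm_cost_greatest ennreal_leI)
    fix w b assume "strict_unit_margin d w b (insert (x, y) (set S))"
    then have um: "unit_margin d w b (insert (x, y) (set S))" by (rule strict_unit_margin_imp)
    show "1 / \<Delta>\<^sup>2 \<le> (norm_d d w)\<^sup>2"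
      using unit_marginD[OF um, of x] unit_marginD[OF um, of x\<^sub>1] x1 y
      by (intro separated_norm_bound[OF _ dist[OF x1] \<Delta>]) (cases y\<^sub>0; simp)
  qed
  moreover have "svm_cost d (set S) = 0"
    by (rule svm_cost_single_label) (rule y0)
  ultimately show ?thesis by simp
next
  case False
  then have "\<not> (\<forall>x y. (x, y) \<in> set S \<longrightarrow> y = False)"
    "\<not> (\<forall>x y. (x, y) \<in> set S \<longrightarrow> y = True)" by metis+
  then obtain x\<^sub>1 x\<^sub>2 where x12: "(x\<^sub>1, True) \<in> set S" "(x\<^sub>2, False) \<in> set S" by auto
  obtain u \<beta> p q where
    u: "\<And>x. linear_classifier d w\<^sub>0 b\<^sub>0 x \<longleftrightarrow> inner_d d u x \<ge> \<beta>"
    "unit_margin d u \<beta> (set S)"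
    "(p, True) \<in> set S" "inner_d d u p = \<beta> + 1" "(q, False) \<in> set S" "inner_d d u q = \<beta> - 1"
    "\<And>w b. unit_margin d w b (set S) \<Longrightarrow> norm_d d u \<le> norm_d d w"
    by (rule max_margin_normal_form[OF mm S(1) x12]) (rule that, assumption+)
  have "ennreal ((norm_d d u)\<^sup>2 + 1 / \<Delta>\<^sup>2) \<le> svm_cost d (insert (x, y) (set S))"
  proof (intro svm_cost_greatest ennreal_leI)
    fix w b assume "strict_unit_margin d w b (insert (x, y) (set S))"
    then have um: "unit_margin d w b (insert (x, y) (set S))" by (rule strict_unit_margin_imp)
    then have umS: "unit_margin d w b (set S)" by (auto simp: unit_margin_def)
    \<comment> \<open>Between the support vector of the opposite label and x, the values of w differ
      by at least 2 in the direction of the labels, while those of u, which errs at x, differ by at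
      most 1. So the values of w - u differ by at least 1.\<close>
    have "1 / \<Delta>\<^sup>2 \<le> (norm_d d (\<lambda>i. w i - u i))\<^sup>2"
    proof (cases y)
      case True
      then have "inner_d d u x < \<beta>" using mistake u(1)[of x] by auto
      then show ?thesis
        using unit_marginD(1)[OF um, of x] unit_marginD(2)[OF umS u(5)] u(6) True
        by (intro separated_norm_bound[OF _ dist[OF u(5)] \<Delta>]) (simp add: inner_d_diff)
    next
      case False
      then have "inner_d d u x \<ge> \<beta>" using mistake u(1)[of x] by auto
      then show ?thesis
        using unit_marginD(2)[OF um, of x] unit_marginD(1)[OF umS u(3)] u(4) False
        by (intro separated_norm_bound[OF _ dist[OF u(3)] \<Delta>]) (simp add: inner_d_diff)
    qed
    moreover have "(norm_d d u)\<^sup>2 + (norm_d d (\<lambda>i. w i - u i))\<^sup>2 \<le> (norm_d d w)\<^sup>2"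
      by (rule minimal_norm_pythagoras[OF u(2) umS]) (erule u(7))
    ultimately show "(norm_d d u)\<^sup>2 + 1 / \<Delta>\<^sup>2 \<le> (norm_d d w)\<^sup>2" by linarith
  qed
  moreover have "svm_cost d (set S) + ennreal (1 / \<Delta>\<^sup>2) \<le> ennreal ((norm_d d u)\<^sup>2) + ennreal (1 / \<Delta>\<^sup>2)"
    by (intro add_right_mono svm_cost_le[OF u(2)])
  ultimately show ?thesis by (simp add: ennreal_plus[symmetric] del: ennreal_plus)
qed

subsection \<open>Measurability and the support of a distribution\<close>

text \<open>For non-measurable \<open>g\<close> the integral is a lower integral, of which only superadditivity survives.\<close>

lemma nn_integral_superadditive:
  assumes [measurable]: "f \<in> borel_measurable M"
  shows "integral\<^sup>N M f + c * integral\<^sup>N M g \<le> (\<integral>\<^sup>+ x. f x + c * g x \<partial>M)"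
proof -
  have "integral\<^sup>N M f + c * integral\<^sup>N M g =
      (SUP h\<in>{h. simple_function M h \<and> h \<le> g}. integral\<^sup>N M f + c * integral\<^sup>S M h)"
    unfolding nn_integral_def[of M g] SUP_mult_left_ennreal
    by (rule ennreal_SUP_add_right) (auto intro!: exI[of _ "\<lambda>_. 0"] simp: le_fun_def)
  also have "\<dots> \<le> (\<integral>\<^sup>+ x. f x + c * g x \<partial>M)"
  proof (rule SUP_least, clarify)
    fix h assume h: "simple_function M h" "h \<le> g"
    then have [measurable]: "h \<in> borel_measurable M" by (simp add: borel_measurable_simple_function)
    have "integral\<^sup>N M f + c * integral\<^sup>S M h = (\<integral>\<^sup>+ x. f x + c * h x \<partial>M)"
      by (simp add: nn_integral_add nn_integral_cmult flip: nn_integral_eq_simple_integral[OF h(1)])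
    also have "\<dots> \<le> (\<integral>\<^sup>+ x. f x + c * g x \<partial>M)"
      using h(2) by (intro nn_integral_mono add_left_mono mult_left_mono) (auto simp: le_fun_def)
    finally show "integral\<^sup>N M f + c * integral\<^sup>S M h \<le> (\<integral>\<^sup>+ x. f x + c * g x \<partial>M)" .
  qed
  finally show ?thesis .
qed

lemma sets_labelled_ball:
  assumes D: "D \<in> distributions d"
  shows "{(x', y') \<in> space D. l2_dist d x x' < e \<and> y' = y} \<in> sets D"
proof -
  note [measurable] = measurable_coordinate[OF D] measurable_label[OF D]
  have "{z \<in> space D. l2_dist d x (fst z) < e \<and> snd z = y} \<in> sets D"
    unfolding l2_dist_def L2_set_def by measurable
  also have "{z \<in> space D. l2_dist d x (fst z) < e \<and> snd z = y} =
      {(x', y') \<in> space D. l2_dist d x x' < e \<and> y' = y}" by auto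
  finally show ?thesis .
qed

text \<open>Every point outside the support has a null ball around it. There may be uncountably many
  such balls, but by Lindeloef countably many of them cover the same set, and a countable union of
  null sets is null.\<close>

lemma AE_labelled_support:
  assumes D: "D \<in> distributions d"
  shows "AE z in D. fst z \<in> labelled_support d D (snd z)"
proof -
  \<comment> \<open>The balls are taken in the whole function space: \<open>l2_dist d x\<close>
    depends continuously on finitely many coordinates, so they are open in the product topology,
    which is second countable.\<close>
  define B where "B = (\<lambda>x e. {x' :: point. l2_dist d x x' < e})"
  define F where "F = (\<lambda>y. {B x e | x e. AE z in D. \<not> (fst z \<in> B x e \<and> snd z = y)})"
  have "continuous_on UNIV (l2_dist d x)" for x
    unfolding l2_dist_def L2_set_def
    by (intro continuous_on_const continuous_on_real_sqrt continuous_on_sum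
        continuous_on_power continuous_on_diff continuous_on_product_coordinates)
  then have "open (B x e)" for x e
    unfolding B_def by (intro open_Collect_less continuous_on_const)
  then have openF: "\<And>S. S \<in> F y \<Longrightarrow> open S" for y by (auto simp: F_def)
  have *: "AE z in D. \<not> (fst z \<in> \<Union>(F y) \<and> snd z = y)" for y
  proof -
    obtain F' where F': "F' \<subseteq> F y" "countable F'" "\<Union>F' = \<Union>(F y)"
      using openF by (rule Lindelof)
    have "AE z in D. \<forall>U\<in>F'. \<not> (fst z \<in> U \<and> snd z = y)"
      using F'(1) by (intro AE_ball_countable' F'(2)) (auto simp: F_def)
    then show ?thesis unfolding F'(3)[symmetric] by eventually_elim auto
  qed
  have cover: "x \<in> \<Union>(F y)" if x: "x \<in> Rd d" "x \<notin> labelled_support d D y" for x y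
  proof -
    obtain e where e: "e > 0" "emeasure D {(x', y') \<in> space D. l2_dist d x x' < e \<and> y' = y} = 0"
      using x by (auto simp: labelled_support_def)
    then have "AE z in D. \<not> (l2_dist d x (fst z) < e \<and> snd z = y)"
      by (subst AE_iff_measurable[OF sets_labelled_ball[OF D, of x e y]]) auto
    then have "B x e \<in> F y" by (auto simp: F_def B_def)
    moreover have "x \<in> B x e" using e(1) by (simp add: B_def l2_dist_def L2_set_def)
    ultimately show ?thesis by blast
  qed
  have "AE z in D. z \<in> space D" by (rule AE_space)
  with *[of True] *[of False] show ?thesis
  proof eventually_elim
    case (elim z)
    then have "fst z \<in> Rd d" by (simp only: distributions_space[OF D] mem_Times_iff)
    then show ?case using cover[of "fst z" "snd z"] elim by (cases "snd z") auto
  qed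
qed

text \<open>A sublevel set is a union over uncountably many pairs (w, b), which countable additivity
  cannot handle; but it is the preimage, under a measurable map, of a union of open sets.\<close>

lemma measurable_svm_cost:
  assumes D: "D \<in> distributions d"
  shows "(\<lambda>S. svm_cost d (S ` {..<n :: nat})) \<in> borel_measurable (\<Pi>\<^sub>M i\<in>{..<n}. D)"
proof (rule borel_measurableI_less)
  fix v :: ennreal
  let ?P = "\<Pi>\<^sub>M i\<in>{..<n}. D"
  \<comment> \<open>The sample becomes one array of reals: entry (i, j) is the signed j-th
    coordinate of the i-th point, and entry (i, d) is the sign itself. The functional margins are
    linear in these entries.\<close>
  define \<phi> :: "(nat \<Rightarrow> example) \<Rightarrow> nat \<times> nat \<Rightarrow> real" where
    "\<phi> = (\<lambda>(S :: nat \<Rightarrow> example) p. if fst p < n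
       then label_sign (snd (S (fst p))) * (if snd p < d then fst (S (fst p)) (snd p) else 1) else 0)"
  define U :: "point \<times> real \<Rightarrow> (nat \<times> nat \<Rightarrow> real) set" where
    "U = (\<lambda>(w, b). (\<Inter>i\<in>{..<n}. {h. 1 < (\<Sum>j<d. w j * h (i, j)) - b * h (i, d)}))"
  have "\<phi> \<in> borel_measurable ?P"
  proof (rule measurable_coordinatewise_then_product, clarify)
    fix i j
    show "(\<lambda>S. \<phi> S (i, j)) \<in> borel_measurable ?P"
    proof (cases "i < n")
      case True
      then have i: "(\<lambda>S. S i) \<in> measurable ?P D" by (intro measurable_component_singleton) simp
      note [measurable] = measurable_compose[OF i measurable_coordinate[OF D]]
        measurable_compose[OF i measurable_label[OF D]]
      show ?thesis using True unfolding \<phi>_def label_sign_def by (cases "j < d") simp_all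
    qed (simp add: \<phi>_def)
  qed
  moreover have "open (U p)" for p
    unfolding U_def split_beta
    by (intro open_INT ballI open_Collect_less continuous_on_const continuous_on_diff continuous_on_sum
        continuous_on_mult continuous_on_product_coordinates) simp
  then have "(\<Union>p\<in>{(w, b). ennreal ((norm_d d w)\<^sup>2) < v}. U p) \<in> sets borel"
    by (intro borel_open open_UN) auto
  ultimately have "\<phi> -` (\<Union>p\<in>{(w, b). ennreal ((norm_d d w)\<^sup>2) < v}. U p) \<inter> space ?P \<in> sets ?P"
    by (rule measurable_sets)
  also have "\<phi> -` (\<Union>p\<in>{(w, b). ennreal ((norm_d d w)\<^sup>2) < v}. U p) \<inter> space ?P =
      {S \<in> space ?P. svm_cost d (S ` {..<n}) < v}"
  proof -
    have "\<phi> S \<in> U (w, b) \<longleftrightarrow> strict_unit_margin d w b (S ` {..<n})" for S w b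
    proof -
      have "(\<Sum>j<d. w j * \<phi> S (i, j)) - b * \<phi> S (i, d) = label_sign (snd (S i)) * (inner_d d w (fst (S i)) - b)"
        if "i < n" for i
        using that by (simp add: \<phi>_def inner_d_def sum_distrib_left algebra_simps)
      then show ?thesis by (auto simp: U_def strict_unit_margin_def split_beta)
    qed
    then show ?thesis by (auto simp: svm_cost_def INF_less_iff; blast)
  qed
  finally show "{S \<in> space ?P. svm_cost d (S ` {..<n}) < v} \<in> sets ?P" .
qed

subsection \<open>Sample complexity of the max margin algorithm\<close>

lemma l2_dist_self [simp]: "l2_dist d x x = 0"
  by (simp add: l2_dist_def L2_set_def)

lemma l2_dist_nonneg [simp]: "0 \<le> l2_dist d x y"
  by (simp add: l2_dist_def)

lemma boundary_dist_nonneg: "0 \<le> boundary_dist d w b x"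
  unfolding boundary_dist_def by (rule INF_greatest) simp

lemma attains_margin_zero: "attains_margin d D \<gamma> \<Longrightarrow> attains_margin d D 0"
  unfolding attains_margin_def zero_ereal_def[symmetric] using boundary_dist_nonneg by blast

lemma margin_attained:
  assumes "has_margin d D"
  shows "attains_margin d D (margin d D)" "0 \<le> margin d D"
proof -
  obtain \<gamma> where "attains_margin d D \<gamma>" "\<And>\<gamma>'. attains_margin d D \<gamma>' \<Longrightarrow> \<gamma>' \<le> \<gamma>"
    using assms unfolding has_margin_def by blast
  moreover from this have "margin d D = \<gamma>"
    unfolding margin_def by (rule Greatest_equality)
  ultimately show "attains_margin d D (margin d D)" "0 \<le> margin d D"
    using attains_margin_zero by blast+
qed

lemma support_dist_le:
  assumes "aspect_ratio d D \<le> ereal \<rho>" "0 \<le> margin d D"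
    and "x \<in> support_points d D" "y \<in> support_points d D"
  shows "l2_dist d x y \<le> \<rho> * margin d D"
proof -
  have "ereal (l2_dist d x y) \<le> diam2 d (support_points d D)"
    unfolding diam2_def using assms(3,4) by (blast intro: SUP_upper2 order_refl)
  then have *: "ereal (l2_dist d x y) / ereal (margin d D) \<le> ereal \<rho>"
    using assms(1,2) unfolding aspect_ratio_def divide_ereal_def
    by (elim order_trans[OF ereal_mult_right_mono]) simp
  show ?thesis
  \<comment> \<open>In the extended reals a positive number divided by 0 is \<infinity>, so a finite
    aspect ratio with margin 0 forces distance 0.\<close>
  proof (cases "margin d D = 0")
    case True
    then show ?thesis using * l2_dist_nonneg[of d x y]
      by (cases "l2_dist d x y = 0") (auto simp: divide_ereal_def zero_ereal_def[symmetric])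
  next
    case False
    then show ?thesis using * assms(2) by (simp add: divide_le_eq)
  qed
qed

text \<open>All that the upper bound needs to know about the distribution. Scaling an optimal
  hyperplane to unit functional margin on the support gives its normal the length 1 / \<gamma>, and
  the diameter is at most \<rho> * \<gamma>, so the product is at most \<rho>.\<close>

lemma separated_family_good_set:
  assumes "D \<in> separated_family d p r \<rho>" "0 < \<rho>"
  obtains G w b \<Delta> where "AE z in D. z \<in> G" "G \<subseteq> Rd d \<times> UNIV" "unit_margin d w b G" "0 < \<Delta>"
    "\<And>z z'. z \<in> G \<Longrightarrow> z' \<in> G \<Longrightarrow> l2_dist d (fst z) (fst z') \<le> \<Delta>" "norm_d d w * \<Delta> \<le> \<rho>"
proof -
  have D: "D \<in> distributions d" "has_margin d D" "aspect_ratio d D \<le> ereal \<rho>"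
    using assms by (auto simp: separated_family_def)
  define \<gamma> where "\<gamma> = margin d D"
  have \<gamma>: "attains_margin d D \<gamma>" "0 \<le> \<gamma>" unfolding \<gamma>_def by (rule margin_attained[OF D(2)])+
  obtain w b where w: "w \<in> Rd d" "std_loss D (linear_classifier d w b) = 0"
    "\<And>x. x \<in> support_points d D \<Longrightarrow> ereal \<gamma> \<le> boundary_dist d w b x"
    using \<gamma>(1) unfolding attains_margin_def by blast
  define G where "G = {z \<in> space D. fst z \<in> labelled_support d D (snd z) \<and>
      linear_classifier d w b (fst z) = snd z}"
  have AEG: "AE z in D. z \<in> G"
    using AE_labelled_support[OF D(1)] w(2)[unfolded std_loss_linear_zero_iff[OF D(1)]] AE_space
    by eventually_elim (simp add: G_def)
  have GR: "G \<subseteq> Rd d \<times> UNIV" unfolding G_def distributions_space[OF D(1)] by auto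
  have supp: "fst z \<in> support_points d D" if "z \<in> G" for z
    using that by (cases "snd z") (auto simp: G_def support_points_def)
  have lc: "linear_classifier d w b (fst z) = snd z" if "z \<in> G" for z using that by (simp add: G_def)
  have dist: "l2_dist d (fst z) (fst z') \<le> \<rho> * \<gamma>" if "z \<in> G" "z' \<in> G" for z z'
    using support_dist_le[OF D(3) _ supp[OF that(1)] supp[OF that(2)]] \<gamma>(2) by (simp add: \<gamma>_def)
  show thesis
  proof (cases "\<gamma> > 0 \<and> norm_d d w > 0")
    case True
    define k where "k = 1 / (\<gamma> * norm_d d w)"
    have k: "k > 0" using True by (simp add: k_def)
    have "unit_margin d (\<lambda>i. k * w i) (k * b) G"
      unfolding unit_margin_def
    proof clarify
      fix x y assume xy: "(x, y) \<in> G"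
      have "ereal \<gamma> \<le> ereal (\<bar>inner_d d w x - b\<bar> / norm_d d w)"
        using w(3)[OF supp[OF xy]] True GR xy by (subst (asm) boundary_dist_eq) auto
      then have "\<gamma> * norm_d d w \<le> \<bar>inner_d d w x - b\<bar>" using True by (simp add: le_divide_eq)
      also have "\<dots> = label_sign y * (inner_d d w x - b)"
        using lc[OF xy] by (cases y) (auto simp: linear_classifier_def)
      finally have "1 \<le> k * (label_sign y * (inner_d d w x - b))"
        using True by (simp add: k_def divide_simps)
      then show "1 \<le> label_sign y * (inner_d d (\<lambda>i. k * w i) x - k * b)"
        unfolding inner_d_scale by (simp add: algebra_simps)
    qed
    moreover have "norm_d d (\<lambda>i. k * w i) * (\<rho> * \<gamma>) \<le> \<rho>"
      unfolding norm_d_scale using True k by (simp add: k_def)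
    ultimately show thesis using True assms(2) by (intro that[OF AEG GR _ _ dist]) auto
  next
    case False
    \<comment> \<open>In the degenerate case either \<gamma> = 0, and all points of \<open>G\<close>
      coincide, or w = 0, and the classifier is constant. Either way only one label occurs, and the
      zero normal has unit margin.\<close>
    have same: "snd z = snd z'" if "z \<in> G" "z' \<in> G" for z z'
    proof -
      have *: "norm_d d w * l2_dist d (fst z) (fst z') = 0"
        using False \<gamma>(2) L2_set_nonneg[of w "{..<d}"] dist[OF that] l2_dist_nonneg[of d "fst z" "fst z'"]
        by (cases "\<gamma> = 0") auto
      then have "inner_d d w (fst z) = inner_d d w (fst z')"
        using inner_d_dist_le[of d w "fst z" "fst z'"] unfolding * by simp
      then show ?thesis
        using lc[OF that(1)] lc[OF that(2)] by (simp add: linear_classifier_def)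
    qed
    define y\<^sub>0 where "y\<^sub>0 = snd (SOME z. z \<in> G)"
    have y0: "snd z = y\<^sub>0" if "z \<in> G" for z
      unfolding y\<^sub>0_def using that by (intro same someI[of "\<lambda>z. z \<in> G"])
    have um: "unit_margin d (\<lambda>_. 0) (- label_sign y\<^sub>0) G"
      by (rule unit_marginI) (use y0 in \<open>force simp: inner_d_def\<close>)+
    \<comment> \<open>The added 1 keeps the distance bound positive when \<gamma> = 0; the product
      with the zero normal is 0 anyway.\<close>
    have dist': "l2_dist d (fst z) (fst z') \<le> \<rho> * \<gamma> + 1" if "z \<in> G" "z' \<in> G" for z z'
      using dist[OF that] by simp
    show thesis
      by (rule that[OF AEG GR um _ dist']) (use assms(2) \<gamma>(2) in \<open>auto simp: L2_set_def add_nonneg_pos\<close>)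
  qed
qed

text \<open>Draw one more example after a sample of size n. It is misclassified with probability
  equal to the loss, and each mistake raises the cost by at least 1 / \<Delta>^2; Fubini then joins
  the new example to the sample. The size is positive because a mistake after the empty sample is
  free: a single example still has cost 0.\<close>

lemma expected_loss_potential_step:
  assumes D: "D \<in> distributions d" and M: "max_margin_algorithm d M"
    and G: "AE z in D. z \<in> G" "G \<subseteq> Rd d \<times> UNIV" "unit_margin d w b G"
    and \<Delta>: "0 < \<Delta>" "\<And>z z'. z \<in> G \<Longrightarrow> z' \<in> G \<Longrightarrow> l2_dist d (fst z) (fst z') \<le> \<Delta>" and n: "0 < n"
  defines "V \<equiv> \<lambda>n. \<integral>\<^sup>+ S. svm_cost d (S ` {..<n}) \<partial>(\<Pi>\<^sub>M i\<in>{..<n}. D)"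
  shows "V n + ennreal (1 / \<Delta>\<^sup>2) * expected_loss (std_loss D) M D n \<le> V (Suc n)"
proof -
  interpret prob_space D by (rule distributions_prob_space[OF D])
  interpret P: product_sigma_finite "\<lambda>_ :: nat. D" by standard
  let ?P = "\<lambda>n. \<Pi>\<^sub>M i\<in>{..<n}. D"
  let ?c = "ennreal (1 / \<Delta>\<^sup>2)"
  let ?L = "\<lambda>S. std_loss D (M (map S [0..<n]))"
  have step: "svm_cost d (S ` {..<n}) + ?c * ?L S \<le> (\<integral>\<^sup>+ z. svm_cost d ((S(n := z)) ` {..<Suc n}) \<partial>D)"
    if S: "\<forall>i<n. S i \<in> G" for S
  proof -
    let ?S = "map S [0..<n]"
    have setS: "set ?S = S ` {..<n}" by (auto simp: atLeast0LessThan)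
    have SG: "set ?S \<subseteq> G" using S by (auto simp: setS)
    have "separates_sample d (restrict w {..<d}) b ?S"
      unfolding separates_sample_def
    proof clarify
      fix x y assume "(x, y) \<in> set ?S"
      then have "(x, y) \<in> G" using SG by blast
      then show "linear_classifier d (restrict w {..<d}) b x = y"
        using unit_marginD[OF G(3), of x] by (cases y) (simp_all add: linear_classifier_def)
    qed
    moreover have "restrict w {..<d} \<in> Rd d" by auto
    moreover have SR: "set ?S \<subseteq> Rd d \<times> UNIV" using SG G(2) by blast
    ultimately obtain w\<^sub>0 b\<^sub>0 where mm: "max_margin_classifier d w\<^sub>0 b\<^sub>0 ?S"
      and eq: "\<And>x. x \<in> Rd d \<Longrightarrow> M ?S x = linear_classifier d w\<^sub>0 b\<^sub>0 x"
      using M unfolding max_margin_algorithm_def by metis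
    define E where "E = {(x, y) \<in> space D. linear_classifier d w\<^sub>0 b\<^sub>0 x \<noteq> y}"
    have E: "E \<in> sets D" unfolding E_def by (rule sets_linear_error[OF D])
    have "{(x, y) \<in> space D. M ?S x \<noteq> y} = E"
      unfolding E_def using eq by (auto simp: distributions_space[OF D])
    then have "?L S = emeasure D E" unfolding std_loss_def using E by simp
    then have "svm_cost d (S ` {..<n}) + ?c * ?L S = (\<integral>\<^sup>+ z. svm_cost d (S ` {..<n}) + ?c * indicator E z \<partial>D)"
      using E by (simp add: nn_integral_add nn_integral_cmult emeasure_space_1)
    also have "\<dots> \<le> (\<integral>\<^sup>+ z. svm_cost d ((S(n := z)) ` {..<Suc n}) \<partial>D)"
    proof (rule nn_integral_mono_AE, use G(1) in eventually_elim)
      fix z assume z: "z \<in> G"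
      have ins: "(S(n := z)) ` {..<Suc n} = insert (fst z, snd z) (S ` {..<n})"
        by (auto simp: lessThan_Suc)
      show "svm_cost d (S ` {..<n}) + ?c * indicator E z \<le> svm_cost d ((S(n := z)) ` {..<Suc n})"
      proof (cases "z \<in> E")
        case True
        then have "linear_classifier d w\<^sub>0 b\<^sub>0 (fst z) \<noteq> snd z" by (auto simp: E_def)
        from svm_cost_mistake[OF mm SR _ this _ \<Delta>(1)] show ?thesis
          unfolding setS ins using n True \<Delta>(2)[OF z] SG setS by fastforce
      next
        case False
        then show ?thesis unfolding ins by (simp add: svm_cost_mono subset_insertI)
      qed
    qed
    finally show ?thesis .
  qed
  have AE_G: "AE S in ?P n. \<forall>i<n. S i \<in> G"
  proof -
    have "AE S in ?P n. \<forall>i\<in>{..<n}. S i \<in> G"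
      by (intro AE_finite_allI AE_PiM_component) (use G(1) prob_space_axioms in auto)
    then show ?thesis by (rule eventually_mono) auto
  qed
  have "V n + ?c * expected_loss (std_loss D) M D n \<le>
      (\<integral>\<^sup>+ S. svm_cost d (S ` {..<n}) + ?c * ?L S \<partial>?P n)"
    unfolding V_def expected_loss_def by (rule nn_integral_superadditive[OF measurable_svm_cost[OF D]])
  also have "\<dots> \<le> (\<integral>\<^sup>+ S. (\<integral>\<^sup>+ z. svm_cost d ((S(n := z)) ` {..<Suc n}) \<partial>D) \<partial>?P n)"
    by (rule nn_integral_mono_AE, use AE_G in eventually_elim) (rule step)
  also have "\<dots> = V (Suc n)"
    unfolding V_def lessThan_Suc[of n]
    by (rule P.product_nn_integral_insert[symmetric])
      (use measurable_svm_cost[OF D, of "Suc n"] in \<open>auto simp: lessThan_Suc\<close>)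
  finally show ?thesis .
qed

lemma svm_cost_expectation_le:
  assumes D: "D \<in> distributions d" and G: "AE z in D. z \<in> G" "unit_margin d w b G"
  shows "(\<integral>\<^sup>+ S. svm_cost d (S ` {..<n :: nat}) \<partial>(\<Pi>\<^sub>M i\<in>{..<n}. D)) \<le> ennreal ((norm_d d w)\<^sup>2)"
proof -
  let ?P = "\<Pi>\<^sub>M i\<in>{..<n}. D"
  interpret P: prob_space ?P by (intro prob_space_PiM distributions_prob_space[OF D])
  have "AE S in ?P. \<forall>i\<in>{..<n}. S i \<in> G"
    by (intro AE_finite_allI AE_PiM_component) (use G(1) distributions_prob_space[OF D] in auto)
  then have "AE S in ?P. svm_cost d (S ` {..<n}) \<le> ennreal ((norm_d d w)\<^sup>2)"
  proof eventually_elim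
    case (elim S)
    then have "unit_margin d w b (S ` {..<n})" using G(2) by (auto simp: unit_margin_def)
    then show ?case by (rule svm_cost_le)
  qed
  then have "(\<integral>\<^sup>+ S. svm_cost d (S ` {..<n}) \<partial>?P) \<le> (\<integral>\<^sup>+ S. ennreal ((norm_d d w)\<^sup>2) \<partial>?P)"
    by (rule nn_integral_mono_AE)
  then show ?thesis by (simp add: P.emeasure_space_1)
qed

lemma expected_loss_le_1:
  assumes D: "D \<in> distributions d"
  shows "expected_loss (std_loss D) A D n \<le> 1"
proof -
  interpret prob_space D by (rule distributions_prob_space[OF D])
  interpret P: prob_space "\<Pi>\<^sub>M i\<in>{..<n}. D" by (intro prob_space_PiM distributions_prob_space[OF D])
  have "std_loss D f \<le> outer_measure_of D (space D)" for f
    unfolding std_loss_def by (rule outer_measure_of_mono) auto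
  then have "std_loss D f \<le> 1" for f by (simp add: emeasure_space_1)
  then have "expected_loss (std_loss D) A D n \<le> (\<integral>\<^sup>+ S. 1 \<partial>(\<Pi>\<^sub>M i\<in>{..<n}. D))"
    unfolding expected_loss_def by (intro nn_integral_mono) simp
  then show ?thesis by (simp add: P.emeasure_space_1)
qed

lemma std_sample_complexity_le:
  assumes "expected_loss (std_loss D) M D n \<le> ennreal \<epsilon>" "real n \<le> c"
  shows "ereal_of_enat (std_sample_complexity \<epsilon> M D) \<le> ereal c"
proof -
  have "std_sample_complexity \<epsilon> M D \<le> enat n"
    unfolding std_sample_complexity_def using assms(1) by (intro INF_lower) simp
  then have "ereal_of_enat (std_sample_complexity \<epsilon> M D) \<le> ereal (real n)"
    by (metis ereal_of_enat_le_iff ereal_of_enat_simps(1))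
  also have "\<dots> \<le> ereal c" using assms(2) by simp
  finally show ?thesis .
qed

lemma max_margin_sample_complexity:
  assumes \<rho>: "1 \<le> \<rho>" and \<epsilon>: "0 < \<epsilon>" and M: "max_margin_algorithm d M"
    and D: "D \<in> separated_family d p r \<rho>"
  shows "ereal_of_enat (std_sample_complexity \<epsilon> M D) \<le> ereal (3 * \<rho>\<^sup>2 / \<epsilon>)"
proof (cases "\<epsilon> < 1")
  \<comment> \<open>Losses are at most 1, so for \<epsilon> \<ge> 1 the empty sample
    suffices.\<close>
  case False
  have "D \<in> distributions d" using D by (simp add: separated_family_def)
  then have "expected_loss (std_loss D) M D 0 \<le> 1" by (rule expected_loss_le_1)
  also have "1 \<le> ennreal \<epsilon>" using False by (simp flip: ennreal_1)
  finally show ?thesis using \<epsilon> by (intro std_sample_complexity_le) auto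
next
  case True
  have dist: "D \<in> distributions d" using D by (simp add: separated_family_def)
  obtain G w b \<Delta> where G: "AE z in D. z \<in> G" "G \<subseteq> Rd d \<times> UNIV" "unit_margin d w b G" "0 < \<Delta>"
    "\<And>z z'. z \<in> G \<Longrightarrow> z' \<in> G \<Longrightarrow> l2_dist d (fst z) (fst z') \<le> \<Delta>" "norm_d d w * \<Delta> \<le> \<rho>"
    by (rule separated_family_good_set[OF D]) (use \<rho> in auto)
  define V where "V = (\<lambda>n. \<integral>\<^sup>+ S. svm_cost d (S ` {..<n :: nat}) \<partial>(\<Pi>\<^sub>M i\<in>{..<n}. D))"
  \<comment> \<open>The added 1 makes N strictly larger than \<rho>^2 / \<epsilon>. Since this
    quotient is at least 1 here, the excess of at most 2 is absorbed by the constant 3.\<close>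
  define N where "N = nat \<lceil>\<rho>\<^sup>2 / \<epsilon>\<rceil> + 1"
  have N: "\<rho>\<^sup>2 / \<epsilon> < real N" "real N \<le> \<rho>\<^sup>2 / \<epsilon> + 2"
    unfolding N_def using \<epsilon> by (simp_all, linarith+)
  have "1 \<le> \<rho>\<^sup>2" using \<rho> by simp
  then have "1 \<le> \<rho>\<^sup>2 / \<epsilon>" using True \<epsilon> by (simp add: le_divide_eq)
  then have N3: "real N \<le> 3 * \<rho>\<^sup>2 / \<epsilon>" using N(2) by linarith
  have "\<exists>n\<in>{1..N}. expected_loss (std_loss D) M D n \<le> ennreal \<epsilon>"
  proof (rule ccontr)
    assume "\<not> (\<exists>n\<in>{1..N}. expected_loss (std_loss D) M D n \<le> ennreal \<epsilon>)"
    then have big: "ennreal \<epsilon> \<le> expected_loss (std_loss D) M D n" if "1 \<le> n" "n \<le> N" for n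
      using that by force
    have "ennreal (real n * (\<epsilon> / \<Delta>\<^sup>2)) \<le> V (Suc n)" if "n \<le> N" for n
      using that
    proof (induction n)
      case (Suc n)
      have "ennreal (real (Suc n) * (\<epsilon> / \<Delta>\<^sup>2)) = ennreal (real n * (\<epsilon> / \<Delta>\<^sup>2)) + ennreal (1 / \<Delta>\<^sup>2) * ennreal \<epsilon>"
        using \<epsilon> by (simp add: algebra_simps add_divide_distrib flip: ennreal_plus ennreal_mult')
      also have "\<dots> \<le> V (Suc n) + ennreal (1 / \<Delta>\<^sup>2) * expected_loss (std_loss D) M D (Suc n)"
        using Suc by (intro add_mono mult_left_mono big) auto
      also have "\<dots> \<le> V (Suc (Suc n))"
        unfolding V_def by (rule expected_loss_potential_step[OF dist M G(1-4)]) (use G(5) in auto)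
      finally show ?case .
    qed simp
    from this[of N] have "ennreal (real N * (\<epsilon> / \<Delta>\<^sup>2)) \<le> ennreal ((norm_d d w)\<^sup>2)"
      unfolding V_def using svm_cost_expectation_le[OF dist G(1,3)] by (meson order_trans order_refl)
    then have "real N * (\<epsilon> / \<Delta>\<^sup>2) \<le> (norm_d d w)\<^sup>2" by simp
    then have "real N * \<epsilon> \<le> (norm_d d w * \<Delta>)\<^sup>2"
      using G(4) by (simp add: power_mult_distrib divide_le_eq)
    also have "\<dots> \<le> \<rho>\<^sup>2" using G(4,6) by (intro power_mono) auto
    finally show False using N(1) \<epsilon> by (simp add: divide_less_eq)
  qed
  then obtain n where n: "n \<le> N" "expected_loss (std_loss D) M D n \<le> ennreal \<epsilon>" by auto
  show ?thesis
    by (rule std_sample_complexity_le[OF n(2)]) (use n(1) N3 in linarith)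
qed

subsection \<open>Distributions with finite support\<close>

lemma sets_singleton_example:
  assumes "D \<in> distributions d" "z \<in> Rd d \<times> UNIV"
  shows "{z} \<in> sets D"
proof -
  obtain x y where z: "z = (x, y)" "x \<in> Rd d" using assms(2) by auto
  have "{x} = (\<Pi>\<^sub>E i\<in>{..<d}. {x i})"
    using z(2) by (intro PiE_singleton[symmetric]) (simp add: PiE_def)
  also have "\<dots> \<in> sets (\<Pi>\<^sub>M i\<in>{..<d}. borel)" by (rule sets_PiM_I_finite) auto
  finally have "{x} \<times> {y} \<in> sets (example_space d)"
    unfolding example_space_def by (rule pair_measureI) simp
  then show ?thesis using assms(1) z(1) by (simp add: distributions_def)
qed

text \<open>By Tychonoff: the ball is a closed subset of a product of intervals [-1, 1] for the
  coordinates below d and of the singleton of \<open>undefined\<close> beyond.\<close>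

lemma compact_unit_ball_Rd: "compact {w \<in> Rd d. norm_d d w \<le> 1}"
proof -
  define B :: "nat \<Rightarrow> real set" where "B = (\<lambda>i. if i < d then {-1..1} else {undefined})"
  have "compactin (product_topology (\<lambda>_. euclidean) UNIV) (PiE UNIV B)"
    unfolding compactin_PiE by (auto simp: B_def)
  then have "compact (PiE UNIV B)"
    by (simp add: euclidean_product_topology flip: compactin_euclidean_iff)
  moreover have "continuous_on UNIV (norm_d d)"
    unfolding L2_set_def by (intro continuous_on_real_sqrt continuous_on_sum continuous_on_power continuous_on_product_coordinates)
  then have "closed {w. norm_d d w \<le> 1}"
    by (intro closed_Collect_le continuous_on_const)
  ultimately have "compact (PiE UNIV B \<inter> {w. norm_d d w \<le> 1})"
    by (rule compact_Int_closed)
  also have "PiE UNIV B \<inter> {w. norm_d d w \<le> 1} = {w \<in> Rd d. norm_d d w \<le> 1}"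
  proof -
    have "\<bar>w i\<bar> \<le> 1" if "norm_d d w \<le> 1" "i < d" for w i
    proof -
      have "\<bar>w i\<bar> \<le> L2_set (\<lambda>i. \<bar>w i\<bar>) {..<d}"
        using that(2) by (intro member_le_L2_set) auto
      also have "\<dots> = norm_d d w" by (simp add: L2_set_def)
      finally show ?thesis using that(1) by simp
    qed
    then have "w \<in> PiE UNIV B \<longleftrightarrow> w \<in> Rd d" if "norm_d d w \<le> 1" for w
    proof (intro iffI)
      assume "w \<in> PiE UNIV B"
      then have "w i \<in> B i" for i by auto
      then have "w i = undefined" if "\<not> i < d" for i using that unfolding B_def by (metis singletonD)
      then show "w \<in> Rd d" by (auto simp: PiE_iff extensional_def)
    next
      assume w: "w \<in> Rd d"
      have "w i \<in> B i" for i
        using w \<open>\<And>w i. norm_d d w \<le> 1 \<Longrightarrow> i < d \<Longrightarrow> \<bar>w i\<bar> \<le> 1\<close>[OF that, of i]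
        by (cases "i < d") (auto simp: B_def abs_le_iff PiE_iff extensional_def)
      then show "w \<in> PiE UNIV B" by auto
    qed
    then show ?thesis by auto
  qed
  finally show ?thesis .
qed

text \<open>Masses are attached to indices rather than to examples, so \<open>g\<close> may send
  several indices to the same example, and their masses add up.\<close>

locale finitely_supported =
  fixes d :: nat and J :: "'a set" and P :: "'a \<Rightarrow> real" and g :: "'a \<Rightarrow> example" and D :: "example measure"
  assumes finite: "finite J" and pos: "\<And>j. j \<in> J \<Longrightarrow> 0 < P j" and total: "sum P J = 1"
    and in_space: "\<And>j. j \<in> J \<Longrightarrow> g j \<in> Rd d \<times> UNIV"
    and D_eq: "D = distr (point_measure J (\<lambda>j. ennreal (P j))) (example_space d) g"
begin

lemma emeasure_eq:
  assumes "C \<in> sets (example_space d)"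
  shows "emeasure D C = (\<Sum>j\<in>J. ennreal (P j) * indicator C (g j))"
proof -
  have "g \<in> measurable (point_measure J (\<lambda>j. ennreal (P j))) (example_space d)"
    using in_space by (auto simp: measurable_def space_point_measure sets_point_measure space_example_space)
  then have "emeasure D C = emeasure (point_measure J (\<lambda>j. ennreal (P j))) (g -` C \<inter> J)"
    unfolding D_eq using assms by (simp add: emeasure_distr space_point_measure)
  also have "\<dots> = (\<Sum>j\<in>g -` C \<inter> J. ennreal (P j))"
    by (rule emeasure_point_measure_finite[OF finite]) auto
  also have "\<dots> = (\<Sum>j\<in>J. ennreal (P j) * indicator C (g j))"
    by (rule sum.mono_neutral_cong_left) (auto simp: finite indicator_def)
  finally show ?thesis .
qed

lemma sets_D: "sets D = sets (example_space d)" by (simp add: D_eq)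

lemma distribution: "D \<in> distributions d"
proof -
  have "space D = space (example_space d)" by (rule sets_eq_imp_space_eq[OF sets_D])
  then have "emeasure D (space D) = (\<Sum>j\<in>J. ennreal (P j))"
    using emeasure_eq[OF sets.top] in_space by (simp add: space_example_space)
  also have "\<dots> = 1" using pos total by (subst sum_ennreal) (auto intro: less_imp_le)
  finally show ?thesis unfolding distributions_def using sets_D by (auto intro: prob_spaceI)
qed

text \<open>A measurable cover of B contains every atom in B. No measurability of B enters, so the
  bound applies to the robust error event of an arbitrary classifier.\<close>

lemma outer_measure_ge: "(\<Sum>j\<in>J. ennreal (P j) * indicator B (g j)) \<le> outer_measure_of D B"
  unfolding outer_measure_of_def
proof (rule INF_greatest, clarify)
  fix C assume C: "C \<in> sets D" "B \<subseteq> C"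
  show "(\<Sum>j\<in>J. ennreal (P j) * indicator B (g j)) \<le> emeasure D C"
    using C sets_D by (subst emeasure_eq) (auto intro!: sum_mono mult_left_mono split: split_indicator)
qed

text \<open>The complement of the finitely many atoms is a measurable null set that covers
  B.\<close>

lemma outer_measure_zero:
  assumes "B \<subseteq> space D" "\<And>j. j \<in> J \<Longrightarrow> g j \<notin> B"
  shows "outer_measure_of D B = 0"
proof -
  have "g ` J \<in> sets D"
  proof (rule sets.countable)
    show "{z} \<in> sets D" if "z \<in> g ` J" for z
      using that in_space by (intro sets_singleton_example[OF distribution]) blast
  qed (simp add: countable_finite finite)
  then have C: "space D - g ` J \<in> sets D" by blast
  have "outer_measure_of D B \<le> outer_measure_of D (space D - g ` J)"
    using assms by (intro outer_measure_of_mono) auto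
  also have "\<dots> = 0"
    using C sets_D by (simp add: emeasure_eq)
  finally show ?thesis by simp
qed

lemma std_loss_zero_iff: "std_loss D f = 0 \<longleftrightarrow> (\<forall>j\<in>J. f (fst (g j)) = snd (g j))"
proof
  assume "std_loss D f = 0"
  let ?B = "{(x, y) \<in> space D. f x \<noteq> y}"
  have "(\<Sum>j\<in>J. ennreal (P j) * indicator ?B (g j)) = 0"
    using outer_measure_ge[of ?B] \<open>std_loss D f = 0\<close> by (simp add: std_loss_def)
  then have zero: "ennreal (P j) * indicator ?B (g j) = 0" if "j \<in> J" for j
    using finite that by (subst (asm) sum_nonneg_eq_0_iff) auto
  have "g j \<notin> ?B" if "j \<in> J" for j
  proof
    assume "g j \<in> ?B"
    then show False using zero[OF that] pos[OF that] by (simp only: indicator_simps) simp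
  qed
  then show "\<forall>j\<in>J. f (fst (g j)) = snd (g j)"
    using in_space by (auto simp: distributions_space[OF distribution] split_beta mem_Times_iff)
next
  assume "\<forall>j\<in>J. f (fst (g j)) = snd (g j)"
  then show "std_loss D f = 0"
    unfolding std_loss_def by (intro outer_measure_zero) (auto simp: split_beta)
qed

lemma labelled_support_eq: "labelled_support d D y = {fst (g j) | j. j \<in> J \<and> snd (g j) = y}"
proof (intro equalityI subsetI)
  fix x assume "x \<in> {fst (g j) | j. j \<in> J \<and> snd (g j) = y}"
  then obtain j where j: "j \<in> J" "x = fst (g j)" "snd (g j) = y" by auto
  show "x \<in> labelled_support d D y"
    unfolding labelled_support_def
  proof (intro CollectI conjI allI impI)
    show "x \<in> Rd d" using in_space[OF j(1)] j(2) by (auto simp: mem_Times_iff)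
    fix e :: real assume "0 < e"
    let ?B = "{(x', y') \<in> space D. l2_dist d x x' < e \<and> y' = y}"
    have "g j \<in> ?B"
      using in_space[OF j(1)] j \<open>0 < e\<close> by (auto simp: distributions_space[OF distribution] split_beta mem_Times_iff)
    then have "0 < ennreal (P j) * indicator ?B (g j)" using pos[OF j(1)] by simp
    also have "\<dots> \<le> (\<Sum>j\<in>J. ennreal (P j) * indicator ?B (g j))"
      using finite j(1) by (intro member_le_sum) auto
    also have "\<dots> = emeasure D ?B"
      using sets_labelled_ball[OF distribution, of x e y] sets_D by (simp add: emeasure_eq)
    finally show "0 < emeasure D ?B" .
  qed
next
  fix x assume x: "x \<in> labelled_support d D y"
  show "x \<in> {fst (g j) | j. j \<in> J \<and> snd (g j) = y}"
  proof (rule ccontr)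
    assume not: "x \<notin> {fst (g j) | j. j \<in> J \<and> snd (g j) = y}"
    have xR: "x \<in> Rd d" using x by (simp add: labelled_support_def)
    define T where "T = {j \<in> J. snd (g j) = y}"
    \<comment> \<open>The 1 keeps the minimum defined when no atom has the label y.\<close>
    define e where "e = Min (insert 1 ((\<lambda>j. l2_dist d x (fst (g j))) ` T))"
    have fin: "finite T" using finite by (simp add: T_def)
    have "0 < l2_dist d x (fst (g j))" if "j \<in> T" for j
    proof (rule ccontr)
      assume "\<not> 0 < l2_dist d x (fst (g j))"
      then have "l2_dist d x (fst (g j)) = 0" using l2_dist_nonneg[of d x "fst (g j)"] by linarith
      then have "\<forall>i<d. x i = fst (g j) i"
        unfolding l2_dist_def by (subst (asm) L2_set_eq_0_iff) auto
      then have "x = fst (g j)"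
        using xR in_space[of j] that by (intro PiE_ext[of _ "{..<d}" "\<lambda>_. UNIV"]) (auto simp: T_def mem_Times_iff)
      then show False using not that by (auto simp: T_def)
    qed
    then have e: "0 < e" unfolding e_def using fin by (subst Min_gr_iff) auto
    let ?B = "{(x', y') \<in> space D. l2_dist d x x' < e \<and> y' = y}"
    have "g j \<notin> ?B" if "j \<in> J" for j
    proof (cases "j \<in> T")
      case True
      then have "e \<le> l2_dist d x (fst (g j))" unfolding e_def using fin by (intro Min_le) auto
      then show ?thesis by auto
    qed (use that in \<open>auto simp: T_def\<close>)
    then have "emeasure D ?B = 0"
      using sets_labelled_ball[OF distribution, of x e y] sets_D by (simp add: emeasure_eq)
    moreover have "0 < emeasure D ?B" using x e by (auto simp: labelled_support_def)
    ultimately show False by simp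
  qed
qed

text \<open>\<open>F\<close> may be non-measurable, but the simple function that equals it on the
  finitely many samples made of atoms, and 0 elsewhere, is a minorant. The samples are collected in
  \<open>W\<close> because different index sequences may produce the same sample.\<close>

lemma nn_integral_sample_ge:
  fixes F :: "example list \<Rightarrow> ennreal"
  shows "(\<Sum>\<phi>\<in>PiE {..<n} (\<lambda>_. J). ennreal (\<Prod>k<n. P (\<phi> k)) * F (map (\<lambda>k. g (\<phi> k)) [0..<n]))
    \<le> (\<integral>\<^sup>+ S. F (map S [0..<n]) \<partial>(\<Pi>\<^sub>M i\<in>{..<n}. D))"
proof -
  let ?P = "\<Pi>\<^sub>M i\<in>{..<n}. D"
  interpret prob_space D by (rule distributions_prob_space[OF distribution])
  interpret PP: product_sigma_finite "\<lambda>_ :: nat. D" by standard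
  define W where "W = PiE {..<n} (\<lambda>_. g ` J)"
  define G where "G = (\<lambda>v. F (map v [0..<n]))"
  have finW: "finite W" unfolding W_def using finite by (intro finite_PiE) auto
  have single: "{z} \<in> sets D" if "z \<in> g ` J" for z
    using that in_space by (intro sets_singleton_example[OF distribution]) auto
  have v_eq: "{v} = PiE {..<n} (\<lambda>k. {v k})" if "v \<in> W" for v
    using that by (intro PiE_singleton[symmetric]) (simp add: W_def PiE_def)
  have v_sets: "{v} \<in> sets ?P" if "v \<in> W" for v
    unfolding v_eq[OF that] using that by (intro sets_PiM_I_finite single) (auto simp: W_def)
  have meas: "emeasure ?P {v} =
      (\<Sum>\<phi>\<in>PiE {..<n} (\<lambda>_. J). ennreal (\<Prod>k<n. P (\<phi> k)) * indicator {v} (\<lambda>k\<in>{..<n}. g (\<phi> k)))"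
    if v: "v \<in> W" for v
  proof -
    have "emeasure ?P {v} = (\<Prod>k<n. emeasure D {v k})"
      unfolding v_eq[OF v] using v by (intro PP.emeasure_PiM single) (auto simp: W_def)
    also have "\<dots> = (\<Prod>k<n. \<Sum>j\<in>J. ennreal (P j) * indicator {v k} (g j))"
    proof (intro prod.cong refl emeasure_eq)
      fix k assume "k \<in> {..<n}"
      then have "v k \<in> g ` J" using v unfolding W_def by (rule PiE_mem[rotated])
      then show "{v k} \<in> sets (example_space d)" using single sets_D by metis
    qed
    also have "\<dots> = (\<Sum>\<phi>\<in>PiE {..<n} (\<lambda>_. J). \<Prod>k<n. ennreal (P (\<phi> k)) * indicator {v k} (g (\<phi> k)))"
      using finite by (subst prod_sum_PiE) auto
    also have "\<dots> = (\<Sum>\<phi>\<in>PiE {..<n} (\<lambda>_. J). ennreal (\<Prod>k<n. P (\<phi> k)) * indicator {v} (\<lambda>k\<in>{..<n}. g (\<phi> k)))"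
    proof (intro sum.cong refl)
      fix \<phi> assume \<phi>: "\<phi> \<in> PiE {..<n} (\<lambda>_. J)"
      have "(\<lambda>k\<in>{..<n}. g (\<phi> k)) = v \<longleftrightarrow> (\<forall>k<n. g (\<phi> k) = v k)"
        using v by (auto simp: W_def PiE_def extensional_def fun_eq_iff)
      then have "indicator {v} (\<lambda>k\<in>{..<n}. g (\<phi> k)) = (\<Prod>k<n. indicator {v k} (g (\<phi> k)) :: ennreal)"
        by (auto simp: indicator_def prod_zero_iff)
      moreover have "ennreal (\<Prod>k<n. P (\<phi> k)) = (\<Prod>k<n. ennreal (P (\<phi> k)))"
        using \<phi> pos by (intro prod_ennreal[symmetric]) (auto intro: less_imp_le)
      ultimately show "(\<Prod>k<n. ennreal (P (\<phi> k)) * indicator {v k} (g (\<phi> k))) =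
          ennreal (\<Prod>k<n. P (\<phi> k)) * indicator {v} (\<lambda>k\<in>{..<n}. g (\<phi> k))"
        by (simp add: prod.distrib)
    qed
    finally show ?thesis .
  qed
  have "(\<Sum>\<phi>\<in>PiE {..<n} (\<lambda>_. J). ennreal (\<Prod>k<n. P (\<phi> k)) * F (map (\<lambda>k. g (\<phi> k)) [0..<n])) =
      (\<Sum>\<phi>\<in>PiE {..<n} (\<lambda>_. J). \<Sum>v\<in>W. G v * (ennreal (\<Prod>k<n. P (\<phi> k)) * indicator {v} (\<lambda>k\<in>{..<n}. g (\<phi> k))))"
  proof (intro sum.cong refl)
    fix \<phi> assume "\<phi> \<in> PiE {..<n} (\<lambda>_. J)"
    then have W: "(\<lambda>k\<in>{..<n}. g (\<phi> k)) \<in> W" by (auto simp: W_def)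
    have "(\<Sum>v\<in>W. G v * (ennreal (\<Prod>k<n. P (\<phi> k)) * indicator {v} (\<lambda>k\<in>{..<n}. g (\<phi> k)))) =
        (\<Sum>v\<in>W. if v = (\<lambda>k\<in>{..<n}. g (\<phi> k)) then G v * ennreal (\<Prod>k<n. P (\<phi> k)) else 0)"
      by (intro sum.cong refl) (auto simp: indicator_def)
    also have "\<dots> = G (\<lambda>k\<in>{..<n}. g (\<phi> k)) * ennreal (\<Prod>k<n. P (\<phi> k))"
      using W finW by simp
    also have "G (\<lambda>k\<in>{..<n}. g (\<phi> k)) = F (map (\<lambda>k. g (\<phi> k)) [0..<n])"
      unfolding G_def by (intro arg_cong[where f = F] map_cong) auto
    finally show "ennreal (\<Prod>k<n. P (\<phi> k)) * F (map (\<lambda>k. g (\<phi> k)) [0..<n]) =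
        (\<Sum>v\<in>W. G v * (ennreal (\<Prod>k<n. P (\<phi> k)) * indicator {v} (\<lambda>k\<in>{..<n}. g (\<phi> k))))"
      by (subst mult.commute) (rule sym)
  qed
  also have "\<dots> = (\<Sum>v\<in>W. G v * emeasure ?P {v})"
    by (subst sum.swap) (simp add: meas sum_distrib_left)
  also have "\<dots> = (\<integral>\<^sup>+ S. (\<Sum>v\<in>W. G v * indicator {v} S) \<partial>?P)"
    using v_sets by (subst nn_integral_sum) (auto simp: nn_integral_cmult_indicator)
  also have "\<dots> \<le> (\<integral>\<^sup>+ S. F (map S [0..<n]) \<partial>?P)"
  proof (rule nn_integral_mono)
    fix S
    have "(\<Sum>v\<in>W. G v * indicator {v} S) = (\<Sum>v\<in>W. if v = S then G v else 0)"
      by (intro sum.cong refl) (auto simp: indicator_def)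
    also have "\<dots> \<le> G S" using finW by simp
    finally show "(\<Sum>v\<in>W. G v * indicator {v} S) \<le> F (map S [0..<n])" by (simp add: G_def)
  qed
  finally show ?thesis .
qed

section \<open>Existence of a largest margin for finite support\<close>

definition points_of :: "bool \<Rightarrow> point set" where
  "points_of y = {fst (g j) | j. j \<in> J \<and> snd (g j) = y}"

lemma finite_points_of: "finite (points_of y)"
proof -
  have "points_of y \<subseteq> fst ` g ` J" by (auto simp: points_of_def)
  then show ?thesis by (rule finite_subset) (use finite in auto)
qed

lemma points_of_Rd: "x \<in> points_of y \<Longrightarrow> x \<in> Rd d"
proof -
  assume "x \<in> points_of y"
  then obtain j where "j \<in> J" "x = fst (g j)" by (auto simp: points_of_def)
  then show "x \<in> Rd d" using in_space[of j] by (cases "g j") simp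
qed

lemma std_loss_zero_points_of:
  "std_loss D f = 0 \<longleftrightarrow> (\<forall>y. \<forall>x\<in>points_of y. f x = y)"
proof -
  have "fst (g j) \<in> points_of (snd (g j))" if "j \<in> J" for j
    using that by (auto simp: points_of_def)
  moreover have "\<exists>j\<in>J. x = fst (g j) \<and> y = snd (g j)" if "x \<in> points_of y" for x y
    using that by (auto simp: points_of_def)
  ultimately show ?thesis unfolding std_loss_zero_iff by metis
qed

lemma support_points_of: "support_points d D = points_of True \<union> points_of False"
  unfolding support_points_def labelled_support_eq points_of_def ..

text \<open>Eliminating the threshold removes the strict inequality at the negative points and
  leaves closed conditions on w and \<gamma>, as compactness requires. The gap is 2\<gamma> because
  a threshold inside it keeps distance \<gamma> from both classes.\<close>

lemma attains_margin_iff: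
  assumes ne: "points_of True \<noteq> {}" "points_of False \<noteq> {}" and \<gamma>: "0 < \<gamma>"
  shows "attains_margin d D \<gamma> \<longleftrightarrow>
    (\<exists>w\<in>Rd d. norm_d d w \<le> 1 \<and> (\<forall>p\<in>points_of True. \<forall>q\<in>points_of False. 2 * \<gamma> \<le> inner_d d w p - inner_d d w q))"
proof
  assume "attains_margin d D \<gamma>"
  then obtain w b where w: "w \<in> Rd d" "std_loss D (linear_classifier d w b) = 0"
    "\<And>x. x \<in> support_points d D \<Longrightarrow> ereal \<gamma> \<le> boundary_dist d w b x"
    unfolding attains_margin_def by blast
  have T: "inner_d d w p \<ge> b" if "p \<in> points_of True" for p
    using w(2) that unfolding std_loss_zero_points_of by (auto simp: linear_classifier_def)
  have F: "inner_d d w q < b" if "q \<in> points_of False" for q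
    using w(2) that unfolding std_loss_zero_points_of linear_classifier_def not_le[symmetric] by blast
  have nz: "norm_d d w > 0"
  proof (rule ccontr)
    assume "\<not> norm_d d w > 0"
    then have "norm_d d w = 0" using L2_set_nonneg[of w "{..<d}"] by linarith
    then show False using ne T F by (fastforce simp: inner_d_zero_norm)
  qed
  have m: "\<gamma> * norm_d d w \<le> \<bar>inner_d d w x - b\<bar>" if "x \<in> points_of y" for x y
  proof -
    have "x \<in> support_points d D" using that unfolding support_points_of by (cases y) auto
    from w(3)[OF this] show ?thesis
      using nz by (simp add: boundary_dist_eq[OF points_of_Rd[OF that] nz] le_divide_eq)
  qed
  define v where "v = restrict (\<lambda>i. 1 / norm_d d w * w i) {..<d}"
  have iv: "inner_d d v x = inner_d d w x / norm_d d w" for x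
    unfolding v_def inner_d_restrict inner_d_scale by simp
  have "norm_d d v = 1"
    unfolding v_def norm_d_restrict norm_d_scale using nz by simp
  moreover have "2 * \<gamma> \<le> inner_d d v p - inner_d d v q"
    if p: "p \<in> points_of True" and q: "q \<in> points_of False" for p q
  proof -
    have "2 * \<gamma> * norm_d d w \<le> inner_d d w p - inner_d d w q"
      using m[OF p] m[OF q] T[OF p] F[OF q] by linarith
    then show ?thesis using nz by (simp add: iv flip: diff_divide_distrib add: le_divide_eq)
  qed
  moreover have "v \<in> Rd d" by (simp add: v_def)
  ultimately show "\<exists>w\<in>Rd d. norm_d d w \<le> 1 \<and> (\<forall>p\<in>points_of True. \<forall>q\<in>points_of False. 2 * \<gamma> \<le> inner_d d w p - inner_d d w q)"
    by (metis order_refl)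
next
  assume "\<exists>w\<in>Rd d. norm_d d w \<le> 1 \<and> (\<forall>p\<in>points_of True. \<forall>q\<in>points_of False. 2 * \<gamma> \<le> inner_d d w p - inner_d d w q)"
  then obtain w where w: "w \<in> Rd d" "norm_d d w \<le> 1"
    "\<And>p q. p \<in> points_of True \<Longrightarrow> q \<in> points_of False \<Longrightarrow> 2 * \<gamma> \<le> inner_d d w p - inner_d d w q" by blast
  obtain p\<^sub>0 where p0: "p\<^sub>0 \<in> points_of True" "\<And>p. p \<in> points_of True \<Longrightarrow> inner_d d w p\<^sub>0 \<le> inner_d d w p"
    using ex_is_arg_min_if_finite[OF finite_points_of ne(1), of "inner_d d w"]
    by (auto simp: is_arg_min_linorder)
  \<comment> \<open>The negative values lie at least 2\<gamma> below the lowest positive one, so a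
    threshold \<gamma> below the latter serves both classes.\<close>
  define b where "b = inner_d d w p\<^sub>0 - \<gamma>"
  have T: "inner_d d w p - b \<ge> \<gamma>" if "p \<in> points_of True" for p using p0(2)[OF that] by (simp add: b_def)
  have F: "inner_d d w q - b \<le> - \<gamma>" if "q \<in> points_of False" for q using w(3)[OF p0(1) that] by (simp add: b_def)
  have nz: "norm_d d w > 0"
  proof (rule ccontr)
    assume "\<not> norm_d d w > 0"
    then have "norm_d d w = 0" using L2_set_nonneg[of w "{..<d}"] by linarith
    moreover obtain q where "q \<in> points_of False" using ne(2) by blast
    ultimately show False using w(3)[OF p0(1), of q] \<gamma> by (simp add: inner_d_zero_norm)
  qed
  have "std_loss D (linear_classifier d w b) = 0"
    unfolding std_loss_zero_points_of
  proof clarify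
    fix y x assume "x \<in> points_of y"
    then show "linear_classifier d w b x = y"
      using T[of x] F[of x] \<gamma> by (cases y) (auto simp: linear_classifier_def)
  qed
  moreover have "ereal \<gamma> \<le> boundary_dist d w b x" if "x \<in> support_points d D" for x
  proof -
    have x: "x \<in> Rd d" and "\<gamma> \<le> \<bar>inner_d d w x - b\<bar>"
      using that T[of x] F[of x] \<gamma> points_of_Rd unfolding support_points_of by auto
    then have "\<gamma> * norm_d d w \<le> \<bar>inner_d d w x - b\<bar>"
      using w(2) \<gamma> mult_left_mono[of "norm_d d w" 1 \<gamma>] by linarith
    then show ?thesis using nz by (simp add: boundary_dist_eq[OF x nz] le_divide_eq)
  qed
  ultimately show "attains_margin d D \<gamma>" unfolding attains_margin_def using w(1) by blast
qed

text \<open>The admissible pairs (w, \<gamma>) with \<gamma> \<ge> 0 form a compact set on which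
  \<gamma> attains its maximum; the distance between any two points of opposite label bounds
  \<gamma>.\<close>

lemma has_margin_of_attains:
  assumes ne: "points_of True \<noteq> {}" "points_of False \<noteq> {}"
    and \<gamma>\<^sub>0: "attains_margin d D \<gamma>\<^sub>0" "0 < \<gamma>\<^sub>0"
  shows "has_margin d D \<and> \<gamma>\<^sub>0 \<le> margin d D"
proof -
  obtain p\<^sub>0 q\<^sub>0 where pq: "p\<^sub>0 \<in> points_of True" "q\<^sub>0 \<in> points_of False" using ne by blast
  define K where "K = {w \<in> Rd d. norm_d d w \<le> 1}"
  define C where "C = l2_dist d p\<^sub>0 q\<^sub>0"
  define T where "T = (K \<times> {0..C}) \<inter> (\<Inter>(p, q)\<in>points_of True \<times> points_of False.
      {t. 2 * snd t \<le> inner_d d (fst t) p - inner_d d (fst t) q})"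
  have cont: "continuous_on UNIV (\<lambda>t :: point \<times> real. inner_d d (fst t) x)" for x
    unfolding inner_d_def
    by (intro continuous_on_sum continuous_on_mult continuous_on_const
        continuous_on_compose2[OF continuous_on_product_coordinates continuous_on_fst] continuous_on_id) auto
  have "closed {t. 2 * snd t \<le> inner_d d (fst t) p - inner_d d (fst t) q}" for p q
    by (intro closed_Collect_le continuous_on_diff cont continuous_on_mult continuous_on_const
        continuous_on_snd continuous_on_id)
  then have "compact T"
    unfolding T_def K_def by (intro compact_Int_closed compact_Times compact_unit_ball_Rd closed_INT) auto
  have T_iff: "(w, \<gamma>) \<in> T \<longleftrightarrow> w \<in> Rd d \<and> norm_d d w \<le> 1 \<and> 0 \<le> \<gamma> \<and>
      (\<forall>p\<in>points_of True. \<forall>q\<in>points_of False. 2 * \<gamma> \<le> inner_d d w p - inner_d d w q)" for w \<gamma>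
  proof -
    have "\<gamma> \<le> C" if w: "norm_d d w \<le> 1" "0 \<le> \<gamma>" "2 * \<gamma> \<le> inner_d d w p\<^sub>0 - inner_d d w q\<^sub>0"
    proof -
      have "2 * \<gamma> \<le> norm_d d w * C"
        using inner_d_dist_le[of d w p\<^sub>0 q\<^sub>0] w(3) by (simp add: C_def)
      also have "\<dots> \<le> 1 * C" using w(1) by (intro mult_right_mono) (auto simp: C_def)
      finally show ?thesis using w(2) by simp
    qed
    then show ?thesis using pq by (auto simp: T_def K_def)
  qed
  have T_margin: "(\<exists>w. (w, \<gamma>) \<in> T) \<longleftrightarrow> attains_margin d D \<gamma>" if "0 < \<gamma>" for \<gamma>
    unfolding attains_margin_iff[OF ne that] T_iff using that by auto
  have "T \<noteq> {}" using T_margin[OF \<gamma>\<^sub>0(2)] \<gamma>\<^sub>0(1) by blast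
  then obtain w \<gamma> where w: "(w, \<gamma>) \<in> T" "\<And>t. t \<in> T \<Longrightarrow> snd t \<le> \<gamma>"
    using continuous_attains_sup[OF \<open>compact T\<close> _ continuous_on_snd[OF continuous_on_id]]
    by (metis prod.collapse)
  have max: "\<gamma>' \<le> \<gamma>" if \<gamma>': "attains_margin d D \<gamma>'" for \<gamma>'
  proof (cases "0 < \<gamma>'")
    case True
    then obtain w' where "(w', \<gamma>') \<in> T" using T_margin \<gamma>' by blast
    then show ?thesis using w(2) by force
  next
    case False
    then show ?thesis using w(1) T_iff[of w \<gamma>] by linarith
  qed
  have "\<gamma>\<^sub>0 \<le> \<gamma>" by (rule max[OF \<gamma>\<^sub>0(1)])
  then have att: "attains_margin d D \<gamma>" using T_margin[of \<gamma>] w(1) \<gamma>\<^sub>0(2) by auto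
  have "margin d D = \<gamma>" unfolding margin_def by (rule Greatest_equality, rule att) (erule max)
  then show ?thesis using att max \<open>\<gamma>\<^sub>0 \<le> \<gamma>\<close> unfolding has_margin_def by blast
qed

end

subsection \<open>The hard distributions\<close>

lemma inner_d_sum_const: "inner_d d w (\<lambda>j. c) = c * sum w {..<d}"
  by (simp add: inner_d_def sum_distrib_left mult.commute)

lemma l2_dist_le_norms: "l2_dist d x y \<le> norm_d d x + norm_d d y"
proof -
  have "l2_dist d x y \<le> norm_d d x + norm_d d (\<lambda>i. - y i)"
    unfolding l2_dist_def using L2_set_triangle_ineq[of x "\<lambda>i. - y i" "{..<d}"] by simp
  then show ?thesis by (simp add: L2_set_def)
qed

text \<open>With the value 0 at p = \<infinity>, the factor d^(-1/p) scales the all-ones vector to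
  unit l_p norm for every p > 1, and 1 / (1 - 1/p) is the dual exponent.\<close>

definition inverse_exponent :: "ereal \<Rightarrow> real" where
  "inverse_exponent p = (if p = \<infinity> then 0 else 1 / real_of_ereal p)"

lemma lp_dist_const:
  assumes d: "1 \<le> d" and p: "1 < p" and xy: "\<And>j. j < d \<Longrightarrow> \<bar>x j - y j\<bar> = c * real d powr - inverse_exponent p"
    and c: "0 \<le> c"
  shows "lp_dist d p x y = c"
proof (cases "p = \<infinity>")
  case True
  have "(\<lambda>i. \<bar>x i - y i\<bar>) ` {..<d} = (\<lambda>i. c) ` {..<d}"
    using d xy True by (intro image_cong) (auto simp: inverse_exponent_def)
  also have "\<dots> = {c}" using d by (auto intro!: image_constant[of 0])
  finally have "(\<lambda>i. \<bar>x i - y i\<bar>) ` {..<d} = {c}" .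
  then show ?thesis using True by (simp add: lp_dist_def)
next
  case False
  define q where "q = real_of_ereal p"
  have q: "1 < q" using p False unfolding q_def by (cases p) auto
  have "(\<Sum>i<d. \<bar>x i - y i\<bar> powr q) = (\<Sum>i<d. c powr q * real d powr -1)"
    using xy c q False by (intro sum.cong) (auto simp: powr_mult powr_powr inverse_exponent_def q_def[symmetric])
  also have "\<dots> = c powr q" using d by (simp add: powr_minus)
  finally show ?thesis
    using False c q by (simp add: lp_dist_def q_def[symmetric] powr_powr)
qed

text \<open>Hoelder's inequality for weights near all-ones. For finite p, Young's inequality is
  applied termwise, which gives the factor 1 + \<kappa> directly from the bound on the power sum,
  without taking a root. For p = \<infinity> the sum of the weights suffices.\<close>

lemma lp_ball_weighted_bound:
  assumes d: "1 \<le> d" and p: "1 < p" and r: "0 < r" and w: "\<And>j. j < d \<Longrightarrow> 0 \<le> w j"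
    and sum_w: "sum w {..<d} = real d" and \<kappa>: "0 \<le> \<kappa>"
    and pow: "p \<noteq> \<infinity> \<Longrightarrow> (\<Sum>j<d. w j powr (1 / (1 - inverse_exponent p))) \<le>
      real d * (1 + 1 / (1 - inverse_exponent p) * \<kappa>)"
    and x': "x' \<in> lp_ball d p x r"
  shows "\<bar>inner_d d w x' - inner_d d w x\<bar> \<le> r * (1 + \<kappa>) * (real d * real d powr - inverse_exponent p)"
proof -
  define z where "z = (\<lambda>j. \<bar>x j - x' j\<bar>)"
  have "inner_d d w x' - inner_d d w x = (\<Sum>j<d. w j * (x' j - x j))"
    by (simp add: inner_d_def sum_subtractf algebra_simps)
  then have le: "\<bar>inner_d d w x' - inner_d d w x\<bar> \<le> (\<Sum>j<d. w j * z j)"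
    by (simp only:) (intro order_trans[OF sum_abs] sum_mono,
        use w in \<open>auto simp: abs_mult z_def abs_minus_commute\<close>)
  show ?thesis
  proof (cases "p = \<infinity>")
    case True
    have "z j \<le> r" if "j < d" for j
    proof -
      have "z j \<le> (MAX i\<in>{..<d}. \<bar>x i - x' i\<bar>)" unfolding z_def using that by (intro Max_ge) auto
      also have "\<dots> \<le> r" using x' True by (simp add: lp_ball_def lp_dist_def)
      finally show ?thesis .
    qed
    then have "(\<Sum>j<d. w j * z j) \<le> (\<Sum>j<d. w j * r)"
      using w by (intro sum_mono mult_left_mono) auto
    also have "\<dots> = r * real d" using sum_w by (simp flip: sum_distrib_right)
    also have "\<dots> \<le> r * (1 + \<kappa>) * real d" using r \<kappa> by (simp add: algebra_simps)
    finally show ?thesis using le d True by (simp add: inverse_exponent_def)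
  next
    case False
    define s where "s = real_of_ereal p"
    have s: "1 < s" using p False unfolding s_def by (cases p) auto
    define q where "q = 1 / (1 - 1 / s)"
    have q: "1 < q" "1 / s + 1 / q = 1" using s unfolding q_def by (auto simp: field_simps)
    define a where "a = real d powr - (1 / s)"
    have a: "0 < a" using d by (simp add: a_def)
    have e: "inverse_exponent p = 1 / s" using False by (simp add: inverse_exponent_def s_def)
    have zr: "(\<Sum>j<d. z j powr s) \<le> r powr s"
    proof -
      have "(\<Sum>j<d. z j powr s) powr (1 / s) \<le> r"
        using x' False by (simp add: lp_ball_def lp_dist_def z_def s_def)
      then have "((\<Sum>j<d. z j powr s) powr (1 / s)) powr s \<le> r powr s"
        using s by (intro powr_mono2) auto
      then show ?thesis using s by (simp add: powr_powr sum_nonneg)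
    qed
    \<comment> \<open>The scaling by r * a makes Young's inequality an equality in the extremal case
      where every displacement is r * a and every weight is 1.\<close>
    have "(\<Sum>j<d. w j * z j) = (\<Sum>j<d. r * a * (z j / (r * a) * w j))"
      using r a by (intro sum.cong) auto
    also have "\<dots> \<le> (\<Sum>j<d. r * a * ((z j / (r * a)) powr s / s + w j powr q / q))"
      using r a s q w by (intro sum_mono mult_left_mono Youngs_inequality) (auto simp: z_def)
    also have "\<dots> = r * a * ((\<Sum>j<d. (z j / (r * a)) powr s) / s + (\<Sum>j<d. w j powr q) / q)"
      by (simp add: sum.distrib flip: sum_distrib_left sum_divide_distrib)
    also have "(\<Sum>j<d. (z j / (r * a)) powr s) = (\<Sum>j<d. z j powr s) * (1 / (r powr s * a powr s))"
      using r a by (simp add: powr_divide powr_mult z_def sum_divide_distrib)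
    also have "a powr s = 1 / real d"
    proof -
      have "a powr s = real d powr (- (1 / s) * s)" unfolding a_def by (rule powr_powr)
      also have "- (1 / s) * s = - 1" using s by simp
      finally show ?thesis using d by (simp add: powr_minus divide_inverse)
    qed
    also have "r * a * ((\<Sum>j<d. z j powr s) * (1 / (r powr s * (1 / real d))) / s + (\<Sum>j<d. w j powr q) / q)
       \<le> r * a * (r powr s * (1 / (r powr s * (1 / real d))) / s + real d * (1 + q * \<kappa>) / q)"
      using r a s q zr pow False
      by (intro mult_left_mono add_mono divide_right_mono mult_right_mono) (auto simp: q_def e)
    also have "\<dots> = r * a * (real d * (1 / s + 1 / q) + real d * \<kappa>)"
      using r q(1) by (simp add: field_simps)
    also have "\<dots> = r * (1 + \<kappa>) * (real d * a)" unfolding q(2) by (simp add: algebra_simps)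
    finally show ?thesis using le by (simp add: a_def e)
  qed
qed

text \<open>Small tilts of the all-ones normal vector change its dual norm only to second order.\<close>

lemma tilt_power_sum:
  fixes a :: "nat \<Rightarrow> real"
  assumes "0 < d" "1 < q" "sum a {..<d} = 0"
  shows "\<forall>\<^sub>F \<kappa> in at_right 0. (\<Sum>j<d. (1 + \<kappa> * a j) powr q) \<le> real d * (1 + q * (\<kappa> / 2))"
proof -
  define F where "F = (\<lambda>\<kappa>. (\<Sum>j<d. (1 + \<kappa> * a j) powr q) - real d * (1 + q * (\<kappa> / 2)))"
  have "(F has_real_derivative (\<Sum>j<d. q * a j) - real d * (q / 2)) (at 0)"
    unfolding F_def by (auto intro!: derivative_eq_intros sum.cong)
  \<comment> \<open>The tilts sum to 0, so the power sum has slope 0 at \<kappa> = 0 and only the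
    negative slope of the allowance remains.\<close>
  also have "(\<Sum>j<d. q * a j) - real d * (q / 2) = - (real d * q / 2)"
    using assms(3) by (simp flip: sum_distrib_left)
  finally have "\<exists>e>0. \<forall>h>0. h < e \<longrightarrow> F 0 > F (0 + h)"
    by (rule DERIV_neg_dec_right) (use assms in auto)
  then obtain e where "0 < e" "\<And>h. 0 < h \<Longrightarrow> h < e \<Longrightarrow> F h < F 0" by auto
  then have "\<forall>\<^sub>F \<kappa> in at_right 0. F \<kappa> < F 0"
    unfolding eventually_at_right_field by auto
  then show ?thesis by eventually_elim (simp add: F_def)
qed

text \<open>Chosen so that tilting the normal compensates the shifts \<open>t\<close>: all hard points with the same label
  get the same inner product with the tilted normal.\<close>

definition tilt :: "nat \<Rightarrow> (nat \<Rightarrow> nat) \<Rightarrow> nat \<Rightarrow> real" where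
  "tilt d t j = 2 * sqrt (real d) * ((\<Sum>i<d. real (t i)) / real d - real (t j))"

lemma sum_tilt: "1 \<le> d \<Longrightarrow> sum (tilt d t) {..<d} = 0"
  unfolding tilt_def by (simp add: sum_subtractf flip: sum_distrib_left)

lemma ennreal_sum_mult:
  assumes "\<And>x. x \<in> X \<Longrightarrow> 0 \<le> f x" "\<And>x. x \<in> X \<Longrightarrow> 0 \<le> g x"
  shows "ennreal (\<Sum>x\<in>X. f x * g x) = (\<Sum>x\<in>X. ennreal (f x) * ennreal (g x))"
  using assms by (subst sum_ennreal[symmetric]) (auto simp: ennreal_mult)

text \<open>The bound on \<kappa> in terms of d and H keeps the tilted weights between 0 and 2 and
  the spread of the positions at most r. In \<open>pow\<close> the tilt is granted only half of the
  slack \<kappa>, so that robust separation is strict.\<close>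

locale hard_family =
  fixes d :: nat and p :: ereal and r :: real and H :: nat and \<kappa> :: real
  assumes d: "1 \<le> d" and p: "1 < p" and r: "0 < r" and H: "0 < H"
    and \<kappa>: "0 < \<kappa>" "2 * sqrt (real d) * real H * \<kappa> \<le> 1"
    and pow: "\<And>t. t \<in> PiE {..<d} (\<lambda>_. {..<H}) \<Longrightarrow> p \<noteq> \<infinity> \<Longrightarrow>
      (\<Sum>j<d. (1 + \<kappa> * tilt d t j) powr (1 / (1 - inverse_exponent p))) \<le>
      real d * (1 + 1 / (1 - inverse_exponent p) * (\<kappa> / 2))"
begin

definition T :: "(nat \<Rightarrow> nat) set" where "T = PiE {..<d} (\<lambda>_. {..<H})"

definition a :: real where "a = real d powr - inverse_exponent p"
text \<open>The Euclidean length of the all-ones vector of l_p length r. Displacing a pair by the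
  same length along its own axis keeps the Euclidean diameter proportional to the margin.\<close>

definition R :: real where "R = r * sqrt (real d) * a"
definition normal :: "(nat \<Rightarrow> nat) \<Rightarrow> point" where "normal t = (\<lambda>j. 1 + \<kappa> * tilt d t j)"
definition offset :: "(nat \<Rightarrow> nat) \<Rightarrow> real" where
  "offset t = R + 2 * \<kappa> * r * a * (\<Sum>i<d. real (t i))"

definition pt :: "nat \<Rightarrow> real \<Rightarrow> point" where
  "pt i \<xi> = restrict (\<lambda>j. (if j = i then R else 0) + \<xi> * a) {..<d}"

text \<open>Measured in l_p along the all-ones line. Opposite labels of a pair are 2r(1 + \<kappa>)
  apart, and the excess 2r\<kappa> over 2r is exactly one step of t.\<close>

definition shift :: "(nat \<Rightarrow> nat) \<Rightarrow> nat \<Rightarrow> bool \<Rightarrow> real" where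
  "shift t i y = 2 * r * \<kappa> * real (t i) + label_sign y * (r * (1 + \<kappa>))"

text \<open>\<open>None\<close> is the uninformative point that carries the remaining mass.\<close>

definition atom :: "(nat \<Rightarrow> nat) \<Rightarrow> (nat \<times> bool) option \<Rightarrow> example" where
  "atom t j = (case j of None \<Rightarrow> (restrict (\<lambda>j. 4 * r * a) {..<d}, True) | Some (i, y) \<Rightarrow> (pt i (shift t i y), y))"

definition J :: "(nat \<times> bool) option set" where "J = insert None (Some ` ({..<d} \<times> UNIV))"

lemma finite_J: "finite J" by (simp add: J_def)

lemma J_cases:
  assumes "j \<in> J"
  obtains "j = None" | i y where "j = Some (i, y)" "i < d"
  using assms by (auto simp: J_def)

lemma atom_simps [simp]:
  "atom t None = (restrict (\<lambda>j. 4 * r * a) {..<d}, True)"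
  "atom t (Some (i, y)) = (pt i (shift t i y), y)"
  by (simp_all add: atom_def)

lemma atom_in_space: "j \<in> J \<Longrightarrow> atom t j \<in> Rd d \<times> UNIV"
  by (erule J_cases) (auto simp: pt_def)

lemma a_pos: "0 < a" using d by (simp add: a_def)

lemma R_pos: "0 < R" using d r a_pos by (simp add: R_def)

lemma sqrt_d: "1 \<le> sqrt (real d)" "sqrt (real d) * sqrt (real d) = real d" "sqrt (real d) \<le> real d"
  using d by (auto simp: real_le_lsqrt power2_eq_square)

lemma \<kappa>_H: "\<kappa> * real H \<le> 1 / 2" "\<kappa> \<le> 1 / 2"
proof -
  have "1 * (2 * real H * \<kappa>) \<le> sqrt (real d) * (2 * real H * \<kappa>)"
    using sqrt_d(1) \<kappa>(1) by (intro mult_right_mono) auto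
  then show *: "\<kappa> * real H \<le> 1 / 2" using \<kappa>(2) by (simp add: algebra_simps)
  have "\<kappa> * 1 \<le> \<kappa> * real H" using H \<kappa>(1) by (intro mult_left_mono) auto
  then show "\<kappa> \<le> 1 / 2" using * by simp
qed

lemma T_le: "t \<in> T \<Longrightarrow> i < d \<Longrightarrow> real (t i) \<le> real H"
  unfolding T_def by (force simp: PiE_iff)

lemma sum_T_le: "t \<in> T \<Longrightarrow> (\<Sum>i<d. real (t i)) \<le> real d * real H"
  using sum_bounded_above[of "{..<d}" "\<lambda>i. real (t i)" "real H"] T_le by simp

lemma tilt_bound:
  assumes "t \<in> T" "j < d"
  shows "\<bar>\<kappa> * tilt d t j\<bar> \<le> 1"
proof -
  have "0 \<le> (\<Sum>i<d. real (t i)) / real d" by (intro divide_nonneg_nonneg sum_nonneg) auto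
  moreover have "(\<Sum>i<d. real (t i)) / real d \<le> real H"
    using sum_T_le[OF assms(1)] d by (simp add: divide_le_eq mult.commute)
  ultimately have "\<bar>(\<Sum>i<d. real (t i)) / real d - real (t j)\<bar> \<le> real H"
    using T_le[OF assms] by simp
  then have "\<kappa> * (2 * sqrt (real d)) * \<bar>(\<Sum>i<d. real (t i)) / real d - real (t j)\<bar> \<le> \<kappa> * (2 * sqrt (real d)) * real H"
    using \<kappa>(1) by (intro mult_left_mono) auto
  also have "\<dots> \<le> 1" using \<kappa>(2) by (simp add: algebra_simps)
  finally show ?thesis using \<kappa>(1) by (simp add: tilt_def abs_mult)
qed

lemma normal_bounds:
  assumes "t \<in> T" "j < d"
  shows "0 \<le> normal t j" "normal t j \<le> 2"
  using tilt_bound[OF assms] by (auto simp: normal_def)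

lemma sum_normal: "sum (normal t) {..<d} = real d"
  unfolding normal_def using sum_tilt[OF d, of t] by (simp add: sum.distrib flip: sum_distrib_left)

lemma norm_normal:
  assumes "t \<in> T"
  shows "norm_d d (normal t) \<le> 2 * sqrt (real d)" "0 < norm_d d (normal t)"
proof -
  have "norm_d d (normal t) \<le> norm_d d (\<lambda>_. 2)"
    using normal_bounds[OF assms] by (intro L2_set_mono) auto
  also have "\<dots> = 2 * sqrt (real d)" by (simp add: L2_set_def real_sqrt_mult)
  finally show "norm_d d (normal t) \<le> 2 * sqrt (real d)" .
  have "norm_d d (normal t) \<noteq> 0"
    using inner_d_zero_norm[of "normal t" d "\<lambda>_. 1"] inner_d_sum_const[of d "normal t" 1] sum_normal[of t] d by auto
  then show "0 < norm_d d (normal t)" using L2_set_nonneg[of "normal t" "{..<d}"] by linarith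
qed

lemma inner_pt:
  assumes "i < d"
  shows "inner_d d (normal t) (pt i \<xi>) = R * normal t i + \<xi> * (real d * a)"
proof -
  have "inner_d d (normal t) (pt i \<xi>) = (\<Sum>j<d. (if j = i then R * normal t i else 0) + \<xi> * a * normal t j)"
    unfolding pt_def inner_d_restrict_right inner_d_def by (intro sum.cong) (auto simp: algebra_simps)
  also have "\<dots> = R * normal t i + \<xi> * a * sum (normal t) {..<d}"
    using assms by (simp add: sum.distrib flip: sum_distrib_left)
  finally show ?thesis by (simp add: sum_normal)
qed

text \<open>The position contributes 2r\<kappa> t(i) d a, and R times the tilt of coordinate i
  removes it, leaving the same sum over all pairs. The factor 2 * sqrt d in \<open>tilt\<close> is
  what makes this exact, since R already carries one sqrt d.\<close>

lemma inner_atom_Some: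
  assumes "i < d"
  shows "inner_d d (normal t) (pt i (shift t i y)) = offset t + label_sign y * (r * (1 + \<kappa>) * (real d * a))"
proof -
  have *: "R * (\<kappa> * tilt d t i) = 2 * \<kappa> * r * a * ((\<Sum>i<d. real (t i)) - real d * real (t i))"
  proof -
    have "R * (\<kappa> * tilt d t i) = 2 * \<kappa> * r * a * (sqrt (real d) * sqrt (real d)) *
        ((\<Sum>i<d. real (t i)) / real d - real (t i))"
      by (simp add: R_def tilt_def)
    moreover have "real d * ((\<Sum>i<d. real (t i)) / real d - real (t i)) =
        (\<Sum>i<d. real (t i)) - real d * real (t i)"
      using d by (simp add: right_diff_distrib)
    ultimately show ?thesis unfolding sqrt_d(2) by (simp only: mult.assoc)
  qed
  have "R * normal t i = R + R * (\<kappa> * tilt d t i)" by (simp add: normal_def algebra_simps)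
  then show ?thesis
    unfolding inner_pt[OF assms] * by (simp add: offset_def shift_def algebra_simps)
qed

lemma atom_margin:
  assumes t: "t \<in> T" and j: "j \<in> J"
  shows "r * (1 + \<kappa>) * (real d * a) \<le> label_sign (snd (atom t j)) * (inner_d d (normal t) (fst (atom t j)) - offset t)"
  using j
proof (cases rule: J_cases)
  case 1
  \<comment> \<open>The 4 leaves room for the offset, at most 2 * r * d * a, and for the margin, at
    most 2 * r * d * a as \<kappa> \<le> 1.\<close>
  have "inner_d d (normal t) (restrict (\<lambda>j. 4 * r * a) {..<d}) = 4 * r * (real d * a)"
    unfolding inner_d_restrict_right inner_d_sum_const sum_normal by simp
  moreover have "R \<le> r * (real d * a)"
    unfolding R_def using r a_pos sqrt_d(3) by (simp add: mult_right_mono)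
  moreover have "2 * \<kappa> * r * a * (\<Sum>i<d. real (t i)) \<le> r * (real d * a)"
  proof -
    have "2 * \<kappa> * r * a * (\<Sum>i<d. real (t i)) \<le> 2 * \<kappa> * r * a * (real d * real H)"
      using \<kappa>(1) r a_pos by (intro mult_left_mono sum_T_le[OF t]) auto
    also have "\<dots> = 2 * (\<kappa> * real H) * (r * (real d * a))" by simp
    also have "\<dots> \<le> 2 * (1 / 2) * (r * (real d * a))"
      using \<kappa>_H r a_pos by (intro mult_right_mono mult_left_mono) auto
    finally show ?thesis by simp
  qed
  moreover have "\<kappa> * (r * (real d * a)) \<le> 1 * (r * (real d * a))"
    using \<kappa>_H(2) r a_pos by (intro mult_right_mono) auto
  ultimately show ?thesis using 1 by (simp add: offset_def algebra_simps)
next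
  case (2 i y)
  then show ?thesis using inner_atom_Some[of i t y] by (cases y) auto
qed

text \<open>Within the ball the inner product changes by at most r(1 + \<kappa>/2) d a, which is
  less than the functional margin r(1 + \<kappa>) d a of every atom.\<close>

lemma robust_on_atom:
  assumes t: "t \<in> T" and j: "j \<in> J" and x': "x' \<in> lp_ball d p (fst (atom t j)) r"
  shows "linear_classifier d (normal t) (offset t) x' = snd (atom t j)"
proof -
  have "\<bar>inner_d d (normal t) x' - inner_d d (normal t) (fst (atom t j))\<bar> \<le> r * (1 + \<kappa> / 2) * (real d * a)"
    unfolding a_def
  proof (rule lp_ball_weighted_bound[OF d p r _ sum_normal _ _ x'])
    show "(\<Sum>j<d. normal t j powr (1 / (1 - inverse_exponent p))) \<le>
      real d * (1 + 1 / (1 - inverse_exponent p) * (\<kappa> / 2))" if "p \<noteq> \<infinity>"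
      using pow[of t] t that by (simp add: normal_def T_def)
  qed (use normal_bounds(1)[OF t] \<kappa>(1) in auto)
  moreover have "r * (1 + \<kappa> / 2) * (real d * a) < r * (1 + \<kappa>) * (real d * a)"
    using r \<kappa>(1) a_pos d by (intro mult_strict_right_mono mult_strict_left_mono) auto
  ultimately show ?thesis
    using atom_margin[OF t j] by (cases "snd (atom t j)") (auto simp: linear_classifier_def)
qed

lemma norm_pt: "norm_d d (pt i \<xi>) \<le> R + \<bar>\<xi>\<bar> * (sqrt (real d) * a)"
proof -
  have "norm_d d (pt i \<xi>) \<le> norm_d d (\<lambda>j. if j = i then R else 0) + norm_d d (\<lambda>j. \<xi> * a)"
    unfolding pt_def norm_d_restrict by (rule L2_set_triangle_ineq)
  moreover have "norm_d d (\<lambda>j. if j = i then R else 0) \<le> R"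
    unfolding L2_set_def using R_pos by (simp add: if_distrib[of "\<lambda>x. x\<^sup>2"] cong: if_cong)
  moreover have "norm_d d (\<lambda>j. \<xi> * a) = \<bar>\<xi>\<bar> * (sqrt (real d) * a)"
    unfolding L2_set_def using a_pos by (simp add: real_sqrt_mult abs_mult)
  ultimately show ?thesis by simp
qed

text \<open>For a point of a pair, R comes from the displacement along its own axis and at most 3R
  from the shift, whose absolute value is at most 3r.\<close>

lemma norm_atom:
  assumes t: "t \<in> T" and j: "j \<in> J"
  shows "norm_d d (fst (atom t j)) \<le> 4 * R"
  using j
proof (cases rule: J_cases)
  case 1
  have "norm_d d (\<lambda>j. 4 * r * a) = 4 * R"
    unfolding L2_set_def R_def using a_pos r by (simp add: real_sqrt_mult)
  then show ?thesis using 1 by simp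
next
  case (2 i y)
  define X where "X = r * (\<kappa> * real (t i))"
  define Y where "Y = r * \<kappa>"
  have "X \<le> r * (\<kappa> * real H)" using r \<kappa>(1) T_le[OF t 2(2)] by (simp add: X_def)
  also have "\<dots> \<le> r * (1 / 2)" using r \<kappa>_H(1) by (intro mult_left_mono) auto
  finally have "X \<le> r / 2" by simp
  moreover have "Y \<le> r * (1 / 2)" unfolding Y_def using r \<kappa>_H(2) by (intro mult_left_mono) auto
  moreover have "0 \<le> X" "0 \<le> Y" using r \<kappa>(1) by (auto simp: X_def Y_def)
  moreover have "shift t i y = 2 * X + label_sign y * (r + Y)"
    by (simp add: shift_def X_def Y_def algebra_simps)
  ultimately have "\<bar>shift t i y\<bar> \<le> 3 * r" using r by (cases y) (auto simp: abs_le_iff)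
  then have "\<bar>shift t i y\<bar> * (sqrt (real d) * a) \<le> 3 * r * (sqrt (real d) * a)"
    using a_pos by (intro mult_right_mono) auto
  also have "3 * r * (sqrt (real d) * a) = 3 * R" by (simp add: R_def)
  finally show ?thesis using 2 norm_pt[of i "shift t i y"] by simp
qed

definition correct_at :: "classifier \<Rightarrow> (nat \<Rightarrow> nat) \<Rightarrow> nat \<Rightarrow> bool" where
  "correct_at f t i \<longleftrightarrow> (\<forall>y. \<forall>x'\<in>lp_ball d p (pt i (shift t i y)) r. f x' = y)"

lemma correct_atD: "correct_at f t i \<Longrightarrow> x' \<in> lp_ball d p (pt i (shift t i y)) r \<Longrightarrow> f x' = y"
  unfolding correct_at_def by metis

lemma lp_dist_pt: "i < d \<Longrightarrow> lp_dist d p (pt i \<xi>) (pt i \<xi>') = \<bar>\<xi> - \<xi>'\<bar>"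
proof (rule lp_dist_const[OF d p])
  fix j assume "j < d"
  then have "pt i \<xi> j - pt i \<xi>' j = (\<xi> - \<xi>') * a" by (simp add: pt_def algebra_simps)
  then show "\<bar>pt i \<xi> j - pt i \<xi>' j\<bar> = \<bar>\<xi> - \<xi>'\<bar> * real d powr - inverse_exponent p"
    using a_pos by (simp add: abs_mult a_def)
qed simp

text \<open>The positive point for a smaller parameter and the negative point for a larger one are at
  distance at most \<open>2r\<close>, so the ball around the midpoint forbids both labels.\<close>

lemma correct_at_not_less:
  assumes t: "t \<in> T" "t' \<in> T" and i: "i < d" and f: "correct_at f t i" "correct_at f t' i"
  shows "\<not> t i < t' i"
proof
  assume less: "t i < t' i"
  define \<xi> where "\<xi> = (shift t i True + shift t' i False) / 2"
  define \<delta> where "\<delta> = shift t i True - shift t' i False"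
  have \<delta>_eq: "\<delta> = 2 * r * (1 + \<kappa> - \<kappa> * (real (t' i) - real (t i)))"
    by (simp add: \<delta>_def shift_def algebra_simps)
  have "\<kappa> * 1 \<le> \<kappa> * (real (t' i) - real (t i))"
    using less \<kappa>(1) by (intro mult_left_mono) auto
  moreover have "\<kappa> * (real (t' i) - real (t i)) \<le> \<kappa> * real H"
    using T_le[OF t(2) i] \<kappa>(1) by (intro mult_left_mono) auto
  ultimately have "0 \<le> 1 + \<kappa> - \<kappa> * (real (t' i) - real (t i))" "1 + \<kappa> - \<kappa> * (real (t' i) - real (t i)) \<le> 1"
    using \<kappa>_H \<kappa>(1) by linarith+
  then have "0 \<le> \<delta>" "\<delta> \<le> 2 * r"
    unfolding \<delta>_eq using r by (auto intro: mult_nonneg_nonneg mult_left_le)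
  then have "\<bar>shift t i True - \<xi>\<bar> \<le> r" "\<bar>shift t' i False - \<xi>\<bar> \<le> r"
    by (auto simp: \<xi>_def \<delta>_def field_simps abs_le_iff)
  moreover have "pt i \<xi> \<in> Rd d" by (simp add: pt_def)
  ultimately have "pt i \<xi> \<in> lp_ball d p (pt i (shift t i True)) r" "pt i \<xi> \<in> lp_ball d p (pt i (shift t' i False)) r"
    by (simp_all only: lp_ball_def mem_Collect_eq lp_dist_pt[OF i] simp_thms)
  then have "f (pt i \<xi>) = True" "f (pt i \<xi>) = False"
    using correct_atD[OF f(1)] correct_atD[OF f(2)] by metis+
  then show False by simp
qed

lemma correct_at_unique:
  assumes "t \<in> T" "t' \<in> T" "i < d" "correct_at f t i" "correct_at f t' i"
  shows "t i = t' i"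
  using correct_at_not_less[OF assms] correct_at_not_less[OF assms(2,1,3,5,4)] by simp

subsection \<open>Averaging over the hard distributions\<close>

definition weight :: "real \<Rightarrow> (nat \<times> bool) option \<Rightarrow> real" where
  "weight \<mu> j = (case j of None \<Rightarrow> 1 - \<mu> | Some _ \<Rightarrow> \<mu> / (2 * real d))"

definition hard_dist :: "real \<Rightarrow> (nat \<Rightarrow> nat) \<Rightarrow> example measure" where
  "hard_dist \<mu> t = distr (point_measure J (\<lambda>j. ennreal (weight \<mu> j))) (example_space d) (atom t)"

lemma sum_J: "(\<Sum>j\<in>J. f j) = f None + (\<Sum>i<d. \<Sum>y\<in>UNIV. f (Some (i, y)))"
proof -
  have "(\<Sum>j\<in>J. f j) = f None + (\<Sum>j\<in>Some ` ({..<d} \<times> UNIV). f j)"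
    unfolding J_def by (subst sum.insert) auto
  also have "(\<Sum>j\<in>Some ` ({..<d} \<times> UNIV). f j) = (\<Sum>iy\<in>{..<d} \<times> UNIV. f (Some iy))"
    by (subst sum.reindex) auto
  also have "\<dots> = (\<Sum>i<d. \<Sum>y\<in>UNIV. f (Some (i, y)))"
    by (simp add: sum.cartesian_product)
  finally show ?thesis .
qed

lemma sum_weight: "sum (weight \<mu>) J = 1"
  using d by (simp add: sum_J weight_def UNIV_bool)

lemma hard_dist_finitely_supported:
  assumes "0 < \<mu>" "\<mu> < 1"
  shows "finitely_supported d J (weight \<mu>) (atom t) (hard_dist \<mu> t)"
proof
  show "0 < weight \<mu> j" if "j \<in> J" for j
    using that assms d by (auto simp: weight_def J_def)
qed (use atom_in_space in \<open>auto simp: finite_J sum_weight hard_dist_def\<close>)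

text \<open>The normal has Euclidean norm at most 2 * sqrt d, so the functional margin r * d * a
  gives a margin of at least R / 2. All atoms have norm at most 4R, hence the diameter is at most 8R
  and the aspect ratio at most 16.\<close>

lemma hard_dist_in_family:
  assumes \<mu>: "0 < \<mu>" "\<mu> < 1" and \<rho>: "20 \<le> \<rho>" and t: "t \<in> T"
  shows "hard_dist \<mu> t \<in> separated_family d p r \<rho>"
proof -
  note F = hard_dist_finitely_supported[OF \<mu>, of t]
  let ?D = "hard_dist \<mu> t"
  define w where "w = restrict (normal t) {..<d}"
  have w: "w \<in> Rd d" by (simp add: w_def)
  have lc: "linear_classifier d w (offset t) x = linear_classifier d (normal t) (offset t) x" for x
    by (simp add: linear_classifier_def w_def)
  have "robust_loss d p r ?D (linear_classifier d w (offset t)) = 0"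
    unfolding robust_loss_def
  proof (rule finitely_supported.outer_measure_zero[OF F])
    fix j assume "j \<in> J"
    then show "atom t j \<notin> {(x, y) \<in> space ?D. \<exists>x'\<in>lp_ball d p x r. linear_classifier d w (offset t) x' \<noteq> y}"
      using robust_on_atom[OF t, of j] by (auto simp: lc split_beta)
  qed auto
  then have sep: "r_separated d p r ?D" unfolding r_separated_def using w by blast
  define \<gamma> where "\<gamma> = R / 2"
  have \<gamma>: "0 < \<gamma>" using R_pos by (simp add: \<gamma>_def)
  have key: "\<gamma> * norm_d d w \<le> label_sign (snd (atom t j)) * (inner_d d w (fst (atom t j)) - offset t)"
    "0 < label_sign (snd (atom t j)) * (inner_d d w (fst (atom t j)) - offset t)" if "j \<in> J" for j
  proof -
    have "\<gamma> * norm_d d w \<le> \<gamma> * (2 * sqrt (real d))"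
      unfolding w_def norm_d_restrict using \<gamma> norm_normal(1)[OF t] by (intro mult_left_mono) auto
    also have "\<dots> = r * (sqrt (real d) * sqrt (real d)) * a" by (simp add: \<gamma>_def R_def)
    also have "\<dots> = r * 1 * (real d * a)" unfolding sqrt_d(2) by simp
    also have "\<dots> \<le> r * (1 + \<kappa>) * (real d * a)"
      using r \<kappa>(1) a_pos by (intro mult_right_mono mult_left_mono) auto
    also have "\<dots> \<le> label_sign (snd (atom t j)) * (inner_d d w (fst (atom t j)) - offset t)"
      using atom_margin[OF t that] by (simp add: w_def)
    finally show *: "\<gamma> * norm_d d w \<le> label_sign (snd (atom t j)) * (inner_d d w (fst (atom t j)) - offset t)" .
    have "0 < \<gamma> * norm_d d w" using \<gamma> norm_normal(2)[OF t] by (simp add: w_def)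
    with * show "0 < label_sign (snd (atom t j)) * (inner_d d w (fst (atom t j)) - offset t)" by linarith
  qed
  have supp: "support_points d ?D = (\<lambda>j. fst (atom t j)) ` J"
    unfolding finitely_supported.support_points_of[OF F] finitely_supported.points_of_def[OF F] by (fastforce simp: image_iff)
  have "attains_margin d ?D \<gamma>"
    unfolding attains_margin_def
  proof (intro bexI[OF _ w] exI[of _ "offset t"] conjI ballI)
    show "std_loss ?D (linear_classifier d w (offset t)) = 0"
      unfolding finitely_supported.std_loss_zero_iff[OF F]
    proof
      fix j assume "j \<in> J"
      then show "linear_classifier d w (offset t) (fst (atom t j)) = snd (atom t j)"
        using key(2)[of j] by (cases "snd (atom t j)") (auto simp: linear_classifier_def)
    qed
    fix x assume "x \<in> support_points d ?D"
    then obtain j where j: "j \<in> J" "x = fst (atom t j)" unfolding supp by blast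
    then have x: "x \<in> Rd d" using atom_in_space[of j t] by (cases "atom t j") auto
    have nz: "0 < norm_d d w" using norm_normal(2)[OF t] by (simp add: w_def)
    have "\<gamma> * norm_d d w \<le> \<bar>inner_d d w x - offset t\<bar>"
      using key(1)[OF j(1)] j(2) by (cases "snd (atom t j)") auto
    then show "ereal \<gamma> \<le> boundary_dist d w (offset t) x"
      using nz by (simp add: boundary_dist_eq[OF x nz] le_divide_eq)
  qed
  moreover have "None \<in> J" "Some (0, False) \<in> J" using d by (auto simp: J_def)
  then have "fst (atom t None) \<in> finitely_supported.points_of J (atom t) True" "fst (atom t (Some (0, False))) \<in> finitely_supported.points_of J (atom t) False"
    unfolding finitely_supported.points_of_def[OF F] by force+
  then have "finitely_supported.points_of J (atom t) True \<noteq> {}" "finitely_supported.points_of J (atom t) False \<noteq> {}" by blast+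
  ultimately have margin: "has_margin d ?D" "\<gamma> \<le> margin d ?D"
    using finitely_supported.has_margin_of_attains[OF F] \<gamma> by blast+
  have "diam2 d (support_points d ?D) \<le> ereal (8 * R)"
    unfolding diam2_def supp
  proof (intro SUP_least, clarify)
    fix j k assume j: "j \<in> J" and k: "k \<in> J"
    then show "ereal (l2_dist d (fst (atom t j)) (fst (atom t k))) \<le> ereal (8 * R)"
      using l2_dist_le_norms[of d "fst (atom t j)" "fst (atom t k)"] norm_atom[OF t j] norm_atom[OF t k]
      by simp
  qed
  then have "aspect_ratio d ?D \<le> ereal (8 * R) / ereal (margin d ?D)"
    unfolding aspect_ratio_def using margin(2) \<gamma> by (intro ereal_divide_right_mono) auto
  also have "\<dots> \<le> ereal \<rho>"
  proof -
    have "8 * R = 16 * \<gamma>" by (simp add: \<gamma>_def)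
    also have "\<dots> \<le> \<rho> * margin d ?D" using \<rho> margin(2) \<gamma> by (intro mult_mono) auto
    finally show ?thesis using margin(2) \<gamma> by (simp add: divide_le_eq)
  qed
  finally show ?thesis
    unfolding separated_family_def using finitely_supported.distribution[OF F] sep margin(1) by simp
qed

definition unseen :: "nat \<Rightarrow> (nat \<Rightarrow> (nat \<times> bool) option) \<Rightarrow> nat \<Rightarrow> bool" where
  "unseen n \<phi> i \<longleftrightarrow> (\<forall>k<n. \<forall>y. \<phi> k \<noteq> Some (i, y))"

definition draws :: "nat \<Rightarrow> (nat \<Rightarrow> (nat \<times> bool) option) set" where
  "draws n = PiE {..<n} (\<lambda>_. J)"

definition learned :: "algorithm \<Rightarrow> nat \<Rightarrow> (nat \<Rightarrow> nat) \<Rightarrow> (nat \<Rightarrow> (nat \<times> bool) option) \<Rightarrow> classifier" where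
  "learned A n t \<phi> = A (map (\<lambda>k. atom t (\<phi> k)) [0..<n])"

definition prob_draw :: "real \<Rightarrow> nat \<Rightarrow> (nat \<Rightarrow> (nat \<times> bool) option) \<Rightarrow> real" where
  "prob_draw \<mu> n \<phi> = (\<Prod>k<n. weight \<mu> (\<phi> k))"

text \<open>The expected number of pairs that are handled robustly although no example of them was
  drawn.\<close>

definition lucky :: "algorithm \<Rightarrow> real \<Rightarrow> nat \<Rightarrow> (nat \<Rightarrow> nat) \<Rightarrow> real" where
  "lucky A \<mu> n t = (\<Sum>\<phi>\<in>draws n. prob_draw \<mu> n \<phi> *
    (\<Sum>i<d. of_bool (unseen n \<phi> i \<and> correct_at (learned A n t \<phi>) t i)))"

lemma finite_draws: "finite (draws n)"
  unfolding draws_def using finite_J by (intro finite_PiE) auto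

lemma weight_nonneg: "0 < \<mu> \<Longrightarrow> \<mu> < 1 \<Longrightarrow> 0 \<le> weight \<mu> j"
  by (simp add: weight_def split: option.split)

lemma prob_draw_nonneg: "0 < \<mu> \<Longrightarrow> \<mu> < 1 \<Longrightarrow> 0 \<le> prob_draw \<mu> n \<phi>"
  unfolding prob_draw_def by (intro prod_nonneg ballI weight_nonneg)

lemma sum_prob_draw: "(\<Sum>\<phi>\<in>draws n. prob_draw \<mu> n \<phi>) = 1"
proof -
  have "(\<Prod>k<n. \<Sum>j\<in>J. weight \<mu> j) = (\<Sum>\<phi>\<in>draws n. prob_draw \<mu> n \<phi>)"
    unfolding draws_def prob_draw_def using finite_J by (subst prod_sum_PiE) auto
  then show ?thesis by (simp add: sum_weight)
qed

text \<open>The pair has total mass \<mu> / d, so it is missed by all n draws with probability (1 -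
  \<mu> / d)^n, and Bernoulli's inequality applies.\<close>

lemma prob_unseen:
  assumes \<mu>: "0 < \<mu>" "\<mu> < 1" and i: "i < d"
  shows "1 - real n * \<mu> / real d \<le> (\<Sum>\<phi>\<in>draws n. prob_draw \<mu> n \<phi> * of_bool (unseen n \<phi> i))"
proof -
  let ?J = "J - {Some (i, True), Some (i, False)}"
  have "(\<Sum>j\<in>?J. weight \<mu> j) = sum (weight \<mu>) J - sum (weight \<mu>) {Some (i, True), Some (i, False)}"
    using i by (intro sum_diff finite_J) (auto simp: J_def)
  also have "\<dots> = 1 - \<mu> / real d"
    unfolding sum_weight using d by (simp add: weight_def field_simps)
  finally have *: "(\<Sum>j\<in>?J. weight \<mu> j) = 1 - \<mu> / real d" .
  have "\<mu> \<le> real d" using \<mu> d by linarith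
  then have "- 1 \<le> - (\<mu> / real d)" using d by (simp add: divide_le_eq)
  then have "1 + real n * (- (\<mu> / real d)) \<le> (1 + (- (\<mu> / real d))) ^ n"
    by (rule Bernoulli_inequality)
  also have "\<dots> = (\<Prod>k<n. \<Sum>j\<in>?J. weight \<mu> j)" unfolding * by simp
  also have "\<dots> = (\<Sum>\<phi>\<in>PiE {..<n} (\<lambda>_. ?J). prob_draw \<mu> n \<phi>)"
    unfolding prob_draw_def using finite_J by (subst prod_sum_PiE) auto
  also have "\<dots> = (\<Sum>\<phi>\<in>draws n. prob_draw \<mu> n \<phi> * of_bool (unseen n \<phi> i))"
  proof (rule sum.mono_neutral_cong_left[OF finite_draws])
    show "PiE {..<n} (\<lambda>_. ?J) \<subseteq> draws n" unfolding draws_def by (intro PiE_mono) auto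
    show "\<forall>\<phi>\<in>draws n - PiE {..<n} (\<lambda>_. ?J). prob_draw \<mu> n \<phi> * of_bool (unseen n \<phi> i) = 0"
    proof
      fix \<phi> assume "\<phi> \<in> draws n - PiE {..<n} (\<lambda>_. ?J)"
      then obtain k where "k < n" "\<phi> k = Some (i, True) \<or> \<phi> k = Some (i, False)"
        unfolding draws_def by (auto simp: PiE_iff)
      then have "\<not> unseen n \<phi> i" unfolding unseen_def by blast
      then show "prob_draw \<mu> n \<phi> * of_bool (unseen n \<phi> i) = 0" by simp
    qed
    fix \<phi> assume \<phi>: "\<phi> \<in> PiE {..<n} (\<lambda>_. ?J)"
    have "unseen n \<phi> i"
      unfolding unseen_def
    proof (intro allI impI)
      fix k y assume "k < n"
      then have "\<phi> k \<in> ?J" using \<phi> by auto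
      then show "\<phi> k \<noteq> Some (i, y)" by (cases y) auto
    qed
    then show "prob_draw \<mu> n \<phi> = prob_draw \<mu> n \<phi> * of_bool (unseen n \<phi> i)" by simp
  qed
  finally show ?thesis by simp
qed

text \<open>A pair that is not handled robustly has an error on at least one of its two atoms. Only
  half of its mass is certain to be lost, which is where the threshold 1/2 for \<epsilon> comes
  from.\<close>

lemma robust_loss_ge:
  assumes \<mu>: "0 < \<mu>" "\<mu> < 1"
  shows "ennreal (\<mu> / (2 * real d) * (\<Sum>i<d. of_bool (\<not> correct_at f t i))) \<le> robust_loss d p r (hard_dist \<mu> t) f"
proof -
  note F = hard_dist_finitely_supported[OF \<mu>, of t]
  define B where "B = {(x, y) \<in> space (hard_dist \<mu> t). \<exists>x'\<in>lp_ball d p x r. f x' \<noteq> y}"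
  have "\<mu> / (2 * real d) * of_bool (\<not> correct_at f t i) \<le>
      (\<Sum>y\<in>UNIV. weight \<mu> (Some (i, y)) * indicator B (atom t (Some (i, y))))" if i: "i < d" for i
  proof (cases "correct_at f t i")
    case False
    then obtain y x' where y: "x' \<in> lp_ball d p (pt i (shift t i y)) r" "f x' \<noteq> y"
      unfolding correct_at_def by blast
    have "Some (i, y) \<in> J" using i by (auto simp: J_def)
    from atom_in_space[OF this, of t] have "atom t (Some (i, y)) \<in> B"
      using y by (auto simp: B_def distributions_space[OF finitely_supported.distribution[OF F]])
    then have "\<mu> / (2 * real d) = weight \<mu> (Some (i, y)) * indicator B (atom t (Some (i, y)))"
      by (simp add: weight_def)
    also have "\<dots> \<le> (\<Sum>y\<in>UNIV. weight \<mu> (Some (i, y)) * indicator B (atom t (Some (i, y))))"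
      by (rule member_le_sum) (auto simp: weight_nonneg[OF \<mu>] simp del: atom_simps)
    finally show ?thesis using False by simp
  qed (auto intro!: sum_nonneg mult_nonneg_nonneg weight_nonneg[OF \<mu>] simp del: atom_simps)
  then have "\<mu> / (2 * real d) * (\<Sum>i<d. of_bool (\<not> correct_at f t i)) \<le>
      (\<Sum>i<d. \<Sum>y\<in>UNIV. weight \<mu> (Some (i, y)) * indicator B (atom t (Some (i, y))))"
    unfolding sum_distrib_left by (intro sum_mono) simp
  also have "\<dots> \<le> (\<Sum>j\<in>J. weight \<mu> j * indicator B (atom t j))"
    unfolding sum_J[of "\<lambda>j. weight \<mu> j * indicator B (atom t j)"]
    using weight_nonneg[OF \<mu>, of None] by (simp del: atom_simps)
  finally have "ennreal (\<mu> / (2 * real d) * (\<Sum>i<d. of_bool (\<not> correct_at f t i))) \<le>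
      ennreal (\<Sum>j\<in>J. weight \<mu> j * indicator B (atom t j))"
    by (rule ennreal_leI)
  also have "\<dots> = (\<Sum>j\<in>J. ennreal (weight \<mu> j) * indicator B (atom t j))"
    using weight_nonneg[OF \<mu>]
    by (subst sum_ennreal[symmetric]) (auto simp: ennreal_mult ennreal_indicator)
  also have "\<dots> \<le> outer_measure_of (hard_dist \<mu> t) B" by (rule finitely_supported.outer_measure_ge[OF F])
  finally show ?thesis unfolding robust_loss_def B_def .
qed

text \<open>An unseen pair is handled wrongly unless it is lucky, and at least d - n\<mu> pairs are
  unseen in expectation.\<close>

lemma expected_robust_loss_ge:
  assumes \<mu>: "0 < \<mu>" "\<mu> < 1"
  shows "ennreal (\<mu> / (2 * real d) * (real d - real n * \<mu> - lucky A \<mu> n t))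
    \<le> expected_loss (robust_loss d p r (hard_dist \<mu> t)) A (hard_dist \<mu> t) n"
proof -
  note F = hard_dist_finitely_supported[OF \<mu>, of t]
  let ?c = "\<mu> / (2 * real d)"
  have "real d - real n * \<mu> = (\<Sum>i<d. 1 - real n * \<mu> / real d)" using d by (simp add: field_simps)
  also have "\<dots> \<le> (\<Sum>i<d. \<Sum>\<phi>\<in>draws n. prob_draw \<mu> n \<phi> * of_bool (unseen n \<phi> i))"
    by (intro sum_mono prob_unseen[OF \<mu>]) simp
  also have "\<dots> = (\<Sum>\<phi>\<in>draws n. prob_draw \<mu> n \<phi> * (\<Sum>i<d. of_bool (unseen n \<phi> i)))"
    by (subst sum.swap, intro sum.cong refl) (rule sum_distrib_left[symmetric])
  finally have "real d - real n * \<mu> - lucky A \<mu> n t \<le> (\<Sum>\<phi>\<in>draws n. prob_draw \<mu> n \<phi> *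
      ((\<Sum>i<d. of_bool (unseen n \<phi> i)) - (\<Sum>i<d. of_bool (unseen n \<phi> i \<and> correct_at (learned A n t \<phi>) t i))))"
    unfolding lucky_def right_diff_distrib sum_subtractf by (rule diff_right_mono)
  also have "\<dots> \<le> (\<Sum>\<phi>\<in>draws n. prob_draw \<mu> n \<phi> * (\<Sum>i<d. of_bool (\<not> correct_at (learned A n t \<phi>) t i)))"
  proof (intro sum_mono mult_left_mono prob_draw_nonneg[OF \<mu>])
    fix \<phi>
    show "(\<Sum>i<d. of_bool (unseen n \<phi> i)) - (\<Sum>i<d. of_bool (unseen n \<phi> i \<and> correct_at (learned A n t \<phi>) t i))
        \<le> (\<Sum>i<d. of_bool (\<not> correct_at (learned A n t \<phi>) t i) :: real)"
      by (subst sum_subtractf[symmetric], rule sum_mono) simp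
  qed
  finally have "?c * (real d - real n * \<mu> - lucky A \<mu> n t) \<le>
      ?c * (\<Sum>\<phi>\<in>draws n. prob_draw \<mu> n \<phi> * (\<Sum>i<d. of_bool (\<not> correct_at (learned A n t \<phi>) t i)))"
    using \<mu> by (intro mult_left_mono) auto
  also have "\<dots> = (\<Sum>\<phi>\<in>draws n. prob_draw \<mu> n \<phi> * (?c * (\<Sum>i<d. of_bool (\<not> correct_at (learned A n t \<phi>) t i))))"
    by (subst sum_distrib_left) (intro sum.cong refl mult.left_commute)
  finally have "ennreal (?c * (real d - real n * \<mu> - lucky A \<mu> n t)) \<le>
      ennreal (\<Sum>\<phi>\<in>draws n. prob_draw \<mu> n \<phi> * (?c * (\<Sum>i<d. of_bool (\<not> correct_at (learned A n t \<phi>) t i))))"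
    by (rule ennreal_leI)
  also have "\<dots> = (\<Sum>\<phi>\<in>draws n. ennreal (prob_draw \<mu> n \<phi>) * ennreal (?c * (\<Sum>i<d. of_bool (\<not> correct_at (learned A n t \<phi>) t i))))"
    using \<mu> by (intro ennreal_sum_mult prob_draw_nonneg mult_nonneg_nonneg sum_nonneg) auto
  also have "\<dots> \<le> (\<Sum>\<phi>\<in>draws n. ennreal (prob_draw \<mu> n \<phi>) * robust_loss d p r (hard_dist \<mu> t) (learned A n t \<phi>))"
    by (intro sum_mono mult_left_mono robust_loss_ge[OF \<mu>]) auto
  also have "\<dots> \<le> expected_loss (robust_loss d p r (hard_dist \<mu> t)) A (hard_dist \<mu> t) n"
    unfolding expected_loss_def draws_def prob_draw_def learned_def by (rule finitely_supported.nn_integral_sample_ge[OF F])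
  finally show ?thesis .
qed

lemma card_T: "card T = H ^ d" "finite T"
  unfolding T_def by (simp_all add: card_PiE finite_PiE)

text \<open>The sample does not involve t(i), so the learned classifier is a function of the other
  coordinates of t, and it is correct for at most one value of t(i). Forgetting coordinate i is
  therefore injective on the lucky parameters, of which at most H^(d-1) remain.\<close>

lemma card_lucky:
  assumes i: "i < d" and u: "unseen n \<phi> i" and \<phi>: "\<phi> \<in> draws n"
  shows "real H * real (card {t \<in> T. correct_at (learned A n t \<phi>) t i}) \<le> real (card T)"
proof -
  let ?L = "{t \<in> T. correct_at (learned A n t \<phi>) t i}"
  let ?\<pi> = "\<lambda>t. restrict t ({..<d} - {i})"
  have "inj_on ?\<pi> ?L"
  proof
    fix t t' assume t: "t \<in> ?L" "t' \<in> ?L" and eq: "?\<pi> t = ?\<pi> t'"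
    have agree: "t j = t' j" if "j < d" "j \<noteq> i" for j
      using fun_cong[OF eq, of j] that by simp
    have "atom t (\<phi> k) = atom t' (\<phi> k)" if "k < n" for k
    proof -
      have "\<phi> k \<in> J" using \<phi> that by (auto simp: draws_def)
      then show ?thesis
      proof (cases rule: J_cases)
        case (2 j y)
        then have "j \<noteq> i" using u that unfolding unseen_def by blast
        then show ?thesis using 2 agree[of j] by (simp add: shift_def)
      qed simp
    qed
    then have "learned A n t \<phi> = learned A n t' \<phi>"
      unfolding learned_def by (intro arg_cong[where f = A] map_cong) auto
    then have "t i = t' i"
      using correct_at_unique[of t t' i "learned A n t \<phi>"] t i by simp
    then show "t = t'"
      using agree t by (intro PiE_ext[of _ "{..<d}" "\<lambda>_. {..<H}"]) (auto simp: T_def)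
  qed
  then have "card ?L \<le> card (PiE ({..<d} - {i}) (\<lambda>_. {..<H}))"
  proof (rule card_inj_on_le)
    show "?\<pi> ` ?L \<subseteq> PiE ({..<d} - {i}) (\<lambda>_. {..<H})"
      by (rule image_subsetI) (auto simp: T_def PiE_iff)
  qed (simp add: finite_PiE)
  also have "\<dots> = H ^ (d - 1)" using i by (simp add: card_PiE)
  finally have "H * card ?L \<le> H * H ^ (d - 1)" by (rule mult_le_mono2)
  also have "\<dots> = card T" using d by (simp add: card_T power_eq_if)
  finally show ?thesis by (simp flip: of_nat_mult)
qed

lemma sum_lucky:
  assumes \<mu>: "0 < \<mu>" "\<mu> < 1"
  shows "(\<Sum>t\<in>T. lucky A \<mu> n t) \<le> real d * (real (card T) / real H)"
proof -
  have "(\<Sum>t\<in>T. lucky A \<mu> n t) = (\<Sum>\<phi>\<in>draws n. prob_draw \<mu> n \<phi> *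
      (\<Sum>i<d. \<Sum>t\<in>T. of_bool (unseen n \<phi> i \<and> correct_at (learned A n t \<phi>) t i)))"
    unfolding lucky_def by (subst sum.swap) (simp add: sum.swap[of _ T] flip: sum_distrib_left)
  also have "\<dots> \<le> (\<Sum>\<phi>\<in>draws n. prob_draw \<mu> n \<phi> * (\<Sum>i<d. real (card T) / real H))"
  proof (intro sum_mono mult_left_mono prob_draw_nonneg[OF \<mu>])
    fix \<phi> i assume \<phi>: "\<phi> \<in> draws n" and i: "i \<in> {..<d}"
    show "(\<Sum>t\<in>T. of_bool (unseen n \<phi> i \<and> correct_at (learned A n t \<phi>) t i)) \<le> real (card T) / real H"
    proof (cases "unseen n \<phi> i")
      case True
      have "(\<Sum>t\<in>T. of_bool (unseen n \<phi> i \<and> correct_at (learned A n t \<phi>) t i)) =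
          real (card {t \<in> T. correct_at (learned A n t \<phi>) t i})"
        using True card_T(2) by (simp add: of_bool_def sum.If_cases Int_def)
      then show ?thesis
        using card_lucky[OF _ True \<phi>, of A] i H by (simp add: le_divide_eq mult.commute)
    qed simp
  qed
  also have "\<dots> = real d * (real (card T) / real H)"
    by (subst sum_distrib_right[symmetric]) (simp add: sum_prob_draw)
  finally show ?thesis .
qed

text \<open>A different good guess could be made for every sample size, so the average is taken over all
  sample sizes at once; this costs only a larger \<open>H\<close>.\<close>

lemma exists_unlucky:
  assumes \<mu>: "0 < \<mu>" "\<mu> < 1"
  obtains t where "t \<in> T" "\<And>n. n < N \<Longrightarrow> lucky A \<mu> n t \<le> real N * real d / real H"
proof -
  let ?f = "\<lambda>t. \<Sum>n<N. lucky A \<mu> n t"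
  have ne: "T \<noteq> {}" using card_T(1) H by auto
  have nonneg: "0 \<le> lucky A \<mu> n t" for n t
    unfolding lucky_def by (intro sum_nonneg mult_nonneg_nonneg prob_draw_nonneg[OF \<mu>]) auto
  have "\<exists>t\<in>T. ?f t \<le> real N * real d / real H"
  proof (rule ccontr)
    assume "\<not> (\<exists>t\<in>T. ?f t \<le> real N * real d / real H)"
    then have "(\<Sum>t\<in>T. real N * real d / real H) < (\<Sum>t\<in>T. ?f t)"
      using ne card_T(2) by (intro sum_strict_mono) auto
    also have "\<dots> = (\<Sum>n<N. \<Sum>t\<in>T. lucky A \<mu> n t)" by (rule sum.swap)
    also have "\<dots> \<le> (\<Sum>n<N. real d * (real (card T) / real H))"
      by (intro sum_mono sum_lucky[OF \<mu>])
    finally show False by (simp add: mult_ac)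
  qed
  then obtain t where t: "t \<in> T" "?f t \<le> real N * real d / real H" by blast
  have "lucky A \<mu> n t \<le> real N * real d / real H" if "n < N" for n
  proof -
    have "lucky A \<mu> n t \<le> ?f t" using that nonneg by (intro member_le_sum) auto
    then show ?thesis using t(2) by linarith
  qed
  with t(1) show thesis by (rule that)
qed

lemma unlucky_distribution:
  assumes \<mu>: "0 < \<mu>" "\<mu> < 1" and \<rho>: "20 \<le> \<rho>" and \<delta>: "0 < \<delta>" "real N / \<delta> \<le> real H"
  shows "\<exists>D\<in>separated_family d p r \<rho>. \<forall>n<N.
    ennreal (\<mu> / 2 * (1 - real n * \<mu> / real d - \<delta>)) \<le> expected_loss (robust_loss d p r D) A D n"
proof -
  obtain t where t: "t \<in> T" "\<And>n. n < N \<Longrightarrow> lucky A \<mu> n t \<le> real N * real d / real H"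
    using exists_unlucky[OF \<mu>] by blast
  show ?thesis
  proof (intro bexI[OF _ hard_dist_in_family[OF \<mu> \<rho> t(1)]] allI impI)
    fix n assume "n < N"
    have "real N * real d / real H \<le> \<delta> * real d"
    proof -
      have "real N \<le> \<delta> * real H" using \<delta> by (simp add: divide_le_eq mult.commute)
      then have "real N * real d \<le> \<delta> * real H * real d" by (intro mult_right_mono) auto
      then show ?thesis using H by (simp add: divide_le_eq mult_ac)
    qed
    then have "lucky A \<mu> n t \<le> \<delta> * real d" using t(2)[OF \<open>n < N\<close>] by linarith
    then have le: "\<mu> / (2 * real d) * (real d - real n * \<mu> - \<delta> * real d) \<le>
        \<mu> / (2 * real d) * (real d - real n * \<mu> - lucky A \<mu> n t)"
      using \<mu> by (intro mult_left_mono) auto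
    have eq: "\<mu> / (2 * real d) * (real d - real n * \<mu> - \<delta> * real d) = \<mu> / 2 * (1 - real n * \<mu> / real d - \<delta>)"
      using d by (simp add: field_simps)
    have "ennreal (\<mu> / 2 * (1 - real n * \<mu> / real d - \<delta>)) \<le>
        ennreal (\<mu> / (2 * real d) * (real d - real n * \<mu> - lucky A \<mu> n t))"
      using le unfolding eq by (rule ennreal_leI)
    also note expected_robust_loss_ge[OF \<mu>]
    finally show "ennreal (\<mu> / 2 * (1 - real n * \<mu> / real d - \<delta>)) \<le>
        expected_loss (robust_loss d p r (hard_dist \<mu> t)) A (hard_dist \<mu> t) n" .
  qed
qed

end

section \<open>Choice of the parameters and the final bounds\<close>

lemma hard_family_exists:
  assumes d: "1 \<le> d" and p: "1 < p" and r: "0 < r" and H: "0 < H"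
  obtains \<kappa> where "hard_family d p r H \<kappa>"
proof -
  define q where "q = 1 / (1 - inverse_exponent p)"
  let ?T = "PiE {..<d} (\<lambda>_. {..<H})"
  \<comment> \<open>For a single t the bound holds for all small \<kappa>; finiteness of the
    parameter set makes it hold for all t with a common \<kappa>.\<close>
  have "\<forall>\<^sub>F \<kappa> in at_right 0. \<forall>t\<in>?T. p \<noteq> \<infinity> \<longrightarrow>
      (\<Sum>j<d. (1 + \<kappa> * tilt d t j) powr q) \<le> real d * (1 + q * (\<kappa> / 2))"
  proof (cases "p = \<infinity>")
    case False
    define s where "s = real_of_ereal p"
    have "1 < s" using p False unfolding s_def by (cases p) auto
    then have q: "1 < q" using False by (simp add: q_def inverse_exponent_def s_def[symmetric])
    have "\<forall>\<^sub>F \<kappa> in at_right 0. (\<Sum>j<d. (1 + \<kappa> * tilt d t j) powr q) \<le> real d * (1 + q * (\<kappa> / 2))" for t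
      using d by (intro tilt_power_sum q sum_tilt) auto
    then have "\<forall>\<^sub>F \<kappa> in at_right 0. \<forall>t\<in>?T. (\<Sum>j<d. (1 + \<kappa> * tilt d t j) powr q) \<le> real d * (1 + q * (\<kappa> / 2))"
      by (intro eventually_ball_finite finite_PiE) auto
    then show ?thesis by (rule eventually_mono) simp
  qed simp
  moreover have "\<forall>\<^sub>F \<kappa> in at_right (0 :: real). 0 < \<kappa>" by (rule eventually_at_right_less)
  moreover have "\<forall>\<^sub>F \<kappa> in at_right 0. 2 * sqrt (real d) * real H * \<kappa> \<le> 1"
  proof -
    have "0 < 2 * sqrt (real d) * real H" using d H by simp
    then show ?thesis
      unfolding eventually_at_right_field
      by (intro exI[of _ "1 / (2 * sqrt (real d) * real H)"]) (auto simp: field_simps)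
  qed
  ultimately have "\<forall>\<^sub>F \<kappa> in at_right 0. hard_family d p r H \<kappa>"
  proof eventually_elim
    case (elim \<kappa>)
    then show ?case using d p r H unfolding hard_family_def q_def by simp
  qed
  then have "\<exists>\<kappa>. hard_family d p r H \<kappa>" by (rule eventually_happens'[rotated]) simp
  then show thesis using that by blast
qed

lemma hard_distribution:
  assumes d: "1 \<le> d" and p: "1 < p" and r: "0 < r" and \<rho>: "20 \<le> \<rho>" and \<mu>: "0 < \<mu>" "\<mu> < 1" and \<delta>: "0 < \<delta>"
  obtains D where "D \<in> separated_family d p r \<rho>"
    "\<And>n. n < N \<Longrightarrow> ennreal (\<mu> / 2 * (1 - real n * \<mu> / real d - \<delta>)) \<le> expected_loss (robust_loss d p r D) A D n"
proof -
  define H where "H = nat \<lceil>real N / \<delta>\<rceil> + 1"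
  have H: "0 < H" "real N / \<delta> \<le> real H" by (auto simp: H_def) linarith
  obtain \<kappa> where "hard_family d p r H \<kappa>" using hard_family_exists[OF d p r H(1)] by blast
  from hard_family.unlucky_distribution[OF this \<mu> \<rho> \<delta> H(2)] show thesis using that by blast
qed

lemma robust_sample_complexity_ge:
  assumes "\<And>n. real n < c \<Longrightarrow> ennreal \<epsilon> < expected_loss (robust_loss d p r D) A D n"
  shows "ereal c \<le> ereal_of_enat (robust_sample_complexity d p r \<epsilon> A D)"
proof (cases "robust_sample_complexity d p r \<epsilon> A D")
  case (enat m)
  let ?S = "{n. expected_loss (robust_loss d p r D) A D n \<le> ennreal \<epsilon>}"
  have "Inf (enat ` ?S) = enat m" using enat by (simp add: robust_sample_complexity_def)
  moreover from this have "enat ` ?S \<noteq> {}" by (metis Inf_enat_def enat.distinct(1))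
  ultimately have "enat m \<in> enat ` ?S"
    by (metis (no_types, lifting) Inf_enat_def LeastI_ex ex_in_conv)
  then have "\<not> ennreal \<epsilon> < expected_loss (robust_loss d p r D) A D m" by auto
  then have "\<not> real m < c" using assms by blast
  then show ?thesis using enat by simp
qed simp

lemma robust_sample_complexity_lower_bound:
  assumes \<epsilon>\<^sub>0: "0 < \<epsilon>\<^sub>0" "\<epsilon>\<^sub>0 < 1 / 2"
  obtains c where "0 < c"
    "\<And>(p :: ereal) (r :: real) (\<rho> :: real) (d :: nat) (A :: algorithm) (\<epsilon> :: real).
      1 < p \<Longrightarrow> 0 < r \<Longrightarrow> 20 < \<rho> \<Longrightarrow> 1 \<le> d \<Longrightarrow> 0 < \<epsilon> \<Longrightarrow> \<epsilon> \<le> \<epsilon>\<^sub>0 \<Longrightarrow>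
      \<exists>D\<in>separated_family d p r \<rho>. ereal (c * real d / \<epsilon>) \<le> ereal_of_enat (robust_sample_complexity d p r \<epsilon> A D)"
proof -
  \<comment> \<open>Any value strictly between the bound on \<epsilon> and 1/2 would do. It makes
    the informative mass \<epsilon> / \<open>\<epsilon>\<^sub>1\<close> less than 1.\<close>
  define \<epsilon>\<^sub>1 where "\<epsilon>\<^sub>1 = (\<epsilon>\<^sub>0 + 1 / 2) / 2"
  have \<epsilon>1: "\<epsilon>\<^sub>0 < \<epsilon>\<^sub>1" "\<epsilon>\<^sub>1 < 1 / 2" "0 < \<epsilon>\<^sub>1" using \<epsilon>\<^sub>0 by (auto simp: \<epsilon>\<^sub>1_def)
  \<comment> \<open>The slack 1 - 2 \<open>\<epsilon>\<^sub>1\<close> is split in three: one third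
    for the pairs seen in the sample, one for the lucky pairs, and one to make the final inequality
    strict.\<close>
  define \<tau> where "\<tau> = (1 - 2 * \<epsilon>\<^sub>1) / 3"
  have \<tau>: "0 < \<tau>" and \<tau>_3: "3 * \<tau> = 1 - 2 * \<epsilon>\<^sub>1" using \<epsilon>1 by (simp_all add: \<tau>_def)
  show thesis
  proof (rule that[of "\<epsilon>\<^sub>1 * \<tau>"])
    show "0 < \<epsilon>\<^sub>1 * \<tau>" using \<epsilon>1 \<tau> by simp
    fix p :: ereal and r \<rho> :: real and d :: nat and A :: algorithm and \<epsilon> :: real
    assume *: "1 < p" "0 < r" "20 < \<rho>" "1 \<le> d" "0 < \<epsilon>" "\<epsilon> \<le> \<epsilon>\<^sub>0"
    define \<mu> where "\<mu> = \<epsilon> / \<epsilon>\<^sub>1"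
    have \<mu>: "0 < \<mu>" "\<mu> < 1" using * \<epsilon>1 by (auto simp: \<mu>_def)
    define x where "x = \<epsilon>\<^sub>1 * \<tau> * real d / \<epsilon>"
    have "20 \<le> \<rho>" using * by simp
    from hard_distribution[OF *(4,1,2) this \<mu> \<tau>, of "nat \<lceil>x\<rceil>" A] obtain D where D: "D \<in> separated_family d p r \<rho>"
      "\<And>n. n < nat \<lceil>x\<rceil> \<Longrightarrow> ennreal (\<mu> / 2 * (1 - real n * \<mu> / real d - \<tau>)) \<le> expected_loss (robust_loss d p r D) A D n"
      by blast
    have "ereal x \<le> ereal_of_enat (robust_sample_complexity d p r \<epsilon> A D)"
    proof (rule robust_sample_complexity_ge)
      fix n assume n: "real n < x"
      have "real n * \<mu> \<le> x * \<mu>" using n \<mu> by (intro mult_right_mono) auto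
      also have "x * \<mu> = \<tau> * real d" using * \<epsilon>1 by (simp add: x_def \<mu>_def)
      finally have "real n * \<mu> / real d \<le> \<tau>" using * by (simp add: divide_le_eq)
      then have "2 * \<epsilon>\<^sub>1 + \<tau> \<le> 1 - real n * \<mu> / real d - \<tau>" using \<tau>_3 by linarith
      then have "2 * \<epsilon>\<^sub>1 < 1 - real n * \<mu> / real d - \<tau>" using \<tau> by linarith
      then have "\<mu> / 2 * (2 * \<epsilon>\<^sub>1) < \<mu> / 2 * (1 - real n * \<mu> / real d - \<tau>)"
        using \<mu> by (intro mult_strict_left_mono) auto
      moreover have "\<mu> / 2 * (2 * \<epsilon>\<^sub>1) = \<epsilon>" using \<epsilon>1 by (simp add: \<mu>_def)
      ultimately have "ennreal \<epsilon> < ennreal (\<mu> / 2 * (1 - real n * \<mu> / real d - \<tau>))"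
        using * by (intro ennreal_lessI) auto
      also have "\<dots> \<le> expected_loss (robust_loss d p r D) A D n" using n by (intro D(2)) linarith
      finally show "ennreal \<epsilon> < expected_loss (robust_loss d p r D) A D n" .
    qed
    then show "\<exists>D\<in>separated_family d p r \<rho>. ereal (\<epsilon>\<^sub>1 * \<tau> * real d / \<epsilon>) \<le> ereal_of_enat (robust_sample_complexity d p r \<epsilon> A D)"
      using D(1) by (auto simp: x_def)
  qed
qed

theorem corollary15:
  shows "(\<forall>\<epsilon>\<^sub>0 < 1 / 2. \<exists>c > 0.
            \<forall>(p::ereal) (r::real) (\<rho>::real) (d::nat) (A::algorithm) (\<epsilon>::real).
              1 < p \<and> 0 < r \<and> 20 < \<rho> \<and> 1 \<le> d \<and> 0 < \<epsilon> \<and> \<epsilon> \<le> \<epsilon>\<^sub>0 \<longrightarrow>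
              (\<exists>D \<in> separated_family d p r \<rho>.
                 ereal_of_enat (robust_sample_complexity d p r \<epsilon> A D) \<ge> ereal (c * real d / \<epsilon>)))
       \<and> (\<exists>c' > 0.
            \<forall>(p::ereal) (r::real) (\<rho>::real) (d::nat) (M::algorithm) (D::example measure) (\<epsilon>::real).
              1 < p \<and> 0 < r \<and> 20 < \<rho> \<and> 1 \<le> d \<and> 0 < \<epsilon> \<and> max_margin_algorithm d M \<and>
              D \<in> separated_family d p r \<rho> \<longrightarrow>
              ereal_of_enat (std_sample_complexity \<epsilon> M D) \<le> ereal (c' * \<rho>\<^sup>2 / \<epsilon>))"
proof
  show "\<forall>\<epsilon>\<^sub>0 < 1 / 2. \<exists>c > 0.
            \<forall>(p::ereal) (r::real) (\<rho>::real) (d::nat) (A::algorithm) (\<epsilon>::real).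
              1 < p \<and> 0 < r \<and> 20 < \<rho> \<and> 1 \<le> d \<and> 0 < \<epsilon> \<and> \<epsilon> \<le> \<epsilon>\<^sub>0 \<longrightarrow>
              (\<exists>D \<in> separated_family d p r \<rho>.
                 ereal_of_enat (robust_sample_complexity d p r \<epsilon> A D) \<ge> ereal (c * real d / \<epsilon>))"
  proof (intro allI impI)
    fix \<epsilon>\<^sub>0 :: real assume "\<epsilon>\<^sub>0 < 1 / 2"
    \<comment> \<open>The given bound on \<epsilon> may be negative or 0; the value 1/4 replaces it
      by a positive one that is still below 1/2.\<close>
    then have "0 < max \<epsilon>\<^sub>0 (1 / 4)" "max \<epsilon>\<^sub>0 (1 / 4) < 1 / 2" by auto
    then obtain c where "0 < c"
      "\<And>(p :: ereal) (r :: real) (\<rho> :: real) (d :: nat) (A :: algorithm) (\<epsilon> :: real).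
      1 < p \<Longrightarrow> 0 < r \<Longrightarrow> 20 < \<rho> \<Longrightarrow> 1 \<le> d \<Longrightarrow> 0 < \<epsilon> \<Longrightarrow> \<epsilon> \<le> max \<epsilon>\<^sub>0 (1 / 4) \<Longrightarrow>
      \<exists>D\<in>separated_family d p r \<rho>. ereal (c * real d / \<epsilon>) \<le> ereal_of_enat (robust_sample_complexity d p r \<epsilon> A D)"
      by (rule robust_sample_complexity_lower_bound) (rule that, assumption, blast)
    then show "\<exists>c > 0.
            \<forall>(p::ereal) (r::real) (\<rho>::real) (d::nat) (A::algorithm) (\<epsilon>::real).
              1 < p \<and> 0 < r \<and> 20 < \<rho> \<and> 1 \<le> d \<and> 0 < \<epsilon> \<and> \<epsilon> \<le> \<epsilon>\<^sub>0 \<longrightarrow>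
              (\<exists>D \<in> separated_family d p r \<rho>.
                 ereal_of_enat (robust_sample_complexity d p r \<epsilon> A D) \<ge> ereal (c * real d / \<epsilon>))"
      by (intro exI[of _ c]) (simp add: le_max_iff_disj)
  qed
next
  show "\<exists>c' > 0.
            \<forall>(p::ereal) (r::real) (\<rho>::real) (d::nat) (M::algorithm) (D::example measure) (\<epsilon>::real).
              1 < p \<and> 0 < r \<and> 20 < \<rho> \<and> 1 \<le> d \<and> 0 < \<epsilon> \<and> max_margin_algorithm d M \<and>
              D \<in> separated_family d p r \<rho> \<longrightarrow>
              ereal_of_enat (std_sample_complexity \<epsilon> M D) \<le> ereal (c' * \<rho>\<^sup>2 / \<epsilon>)"
    using max_margin_sample_complexity by (intro exI[of _ 3]) auto
qed

end
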